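(* Let $m,n$ be relatively prime positive integers. The map $B$ is a bijection from the set $\mathcal{PT}_m^n$ of parking $(m,n)$-filter tuples to the set $\mathcal{PW}_m^n$ of $(m,n)$-parking words.
   Context: The level of $(i,j)\in\mathbb{Z}^2$ is $\ell(i,j)=im+jn$. Order $\mathbb{Z}^2$ componentwise. An $(m,n)$-filter is a nonempty proper subset $\mathfrak{i}\subsetneq\mathbb{Z}^2$ which is upward closed and such that whenever $(i,j)\in\mathfrak{i}$, every point with the same level lies in $\mathfrak{i}$. Let $m(\mathfrak{i})$ be the set of the numbers $\min\{\ell(i,j):(i,j)\in\mathfrak{i}\}$ for $j\in\mathbb{Z}$ (minimum over $i$ with $j$ fixed); it consists of $m$ integers, one per residue class mod $m$. An $(m,n)$-filter is Dyck if the minimum level of its points is $0$. An $(m,n)$-filter tuple is a tuple of $(m,n)$-filters $(\mathfrak{p}^{(0)},\ldots,\mathfrak{p}^{(n)})$ with integers $p_0,\ldots,p_{n-1}$ such that $p_i\in m(\mathfrak{p}^{(i)})$ and $m(\mathfrak{p}^{(i+1)})=(m(\mathfrak{p}^{(i)})\setminus\{p_i\})\cup\{p_i+m\}$ for $0\le i<n$, and $m(\mathfrak{p}^{(n)})=\{x+n:x\in m(\mathfrak{p}^{(0)})\}$. It is parking if $\mathfrak{p}^{(0)}$ is Dyck. $B(\mathfrak{p})={\sf w}_0\cdots{\sf w}_{n-1}\in[m]^n$ where ${\sf w}_i=|\{x\in m(\mathfrak{p}^{(i)}):x<p_i\}|$. $[m]=\{0,\ldots,m-1\}$; $\mathcal{PW}_m^n$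 is the set of ${\sf p}\in[m]^n$ with $|\{j:{\sf p}_j<i\}|\ge in/m$ for $1\le i\le m$. *)

theory Defs
  imports Complex_Main
begin

definition level :: "nat \<Rightarrow> nat \<Rightarrow> int \<times> int \<Rightarrow> int" where
  "level m n = (\<lambda>(i, j). i * int m + j * int n)"

definition mn_filter :: "nat \<Rightarrow> nat \<Rightarrow> (int \<times> int) set \<Rightarrow> bool" where
  "mn_filter m n F \<longleftrightarrow>
     F \<noteq> {} \<and> F \<noteq> UNIV \<and>
     (\<forall>i j i' j'. (i, j) \<in> F \<longrightarrow> i \<le> i' \<longrightarrow> j \<le> j' \<longrightarrow> (i', j') \<in> F) \<and>
     (\<forall>p q. p \<in> F \<longrightarrow> level m n q = level m n p \<longrightarrow> q \<in> F)"

text \<open>Levels in a row form an infinite set, so \<open>Min\<close> is not available; \<open>x\<close> is required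
  explicitly to be the least level of a point of \<open>F\<close> with second coordinate \<open>j\<close>.\<close>

definition row_minima :: "nat \<Rightarrow> nat \<Rightarrow> (int \<times> int) set \<Rightarrow> int set" where
  "row_minima m n F =
     {x. \<exists>j. (\<exists>i. (i, j) \<in> F \<and> level m n (i, j) = x) \<and>
             (\<forall>i. (i, j) \<in> F \<longrightarrow> x \<le> level m n (i, j))}"

definition dyck :: "nat \<Rightarrow> nat \<Rightarrow> (int \<times> int) set \<Rightarrow> bool" where
  "dyck m n F \<longleftrightarrow> (\<exists>p\<in>F. level m n p = 0) \<and> (\<forall>p\<in>F. 0 \<le> level m n p)"

text \<open>A filter tuple carries its filters (list entries \<open>0, \<dots>, n\<close>) together with the
  integers \<open>p\<^sub>0, \<dots>, p\<^sub>n\<^sub>-\<^sub>1\<close>; the latter are determined by the former, see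
  \<open>filter_tuple_labels_unique\<close>.\<close>

definition filter_tuple ::
  "nat \<Rightarrow> nat \<Rightarrow> (int \<times> int) set list \<times> int list \<Rightarrow> bool" where
  "filter_tuple m n = (\<lambda>(fs, ps).
     length fs = n + 1 \<and> length ps = n \<and>
     (\<forall>F\<in>set fs. mn_filter m n F) \<and>
     (\<forall>i<n. ps ! i \<in> row_minima m n (fs ! i) \<and>
        row_minima m n (fs ! (i + 1)) =
          (row_minima m n (fs ! i) - {ps ! i}) \<union> {ps ! i + int m}) \<and>
     row_minima m n (fs ! n) = {x + int n | x. x \<in> row_minima m n (fs ! 0)})"

lemma filter_tuple_labels_unique:
  assumes "0 < m" "filter_tuple m n (fs, ps)" "filter_tuple m n (fs, qs)"
  shows "ps = qs"
proof (rule nth_equalityI)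
  show "length ps = length qs" using assms by (simp add: filter_tuple_def)
next
  fix i assume "i < length ps"
  then have "i < n" using assms(2) by (simp add: filter_tuple_def)
  let ?A = "row_minima m n (fs ! i)" and ?B = "row_minima m n (fs ! (i + 1))"
  have p: "ps ! i \<in> ?A" "?B = (?A - {ps ! i}) \<union> {ps ! i + int m}"
    and q: "qs ! i \<in> ?A" "?B = (?A - {qs ! i}) \<union> {qs ! i + int m}"
    using assms(2,3) \<open>i < n\<close> unfolding filter_tuple_def by auto
  have "ps ! i \<notin> ?B" using p(2) assms(1) by simp
  then show "ps ! i = qs ! i" using p(1) q(2) by blast
qed

definition parking_tuples ::
  "nat \<Rightarrow> nat \<Rightarrow> ((int \<times> int) set list \<times> int list) set" where
  "parking_tuples m n = {(fs, ps). filter_tuple m n (fs, ps) \<and> dyck m n (fs ! 0)}"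

definition B_map ::
  "nat \<Rightarrow> nat \<Rightarrow> (int \<times> int) set list \<times> int list \<Rightarrow> nat list" where
  "B_map m n = (\<lambda>(fs, ps).
     map (\<lambda>i. card {x \<in> row_minima m n (fs ! i). x < ps ! i}) [0..<n])"

definition parking_words :: "nat \<Rightarrow> nat \<Rightarrow> nat list set" where
  "parking_words m n =
     {w. length w = n \<and> set w \<subseteq> {0..<m} \<and>
         (\<forall>i\<in>{1..m}. real (card {j. j < n \<and> w ! j < i}) \<ge> real i * real n / real m)}"

end

theory Submission
  imports Defs "HOL-Combinatorics.Permutations" "HOL-Library.FuncSet"
begin

text \<open>Record the set of row minima of a filter by its increasing enumeration. A letter \<open>k\<close> of a word
  then adds \<open>m\<close> to the entry of rank \<open>k\<close> and sorts again, and a tuple with image \<open>w\<close> is a state which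
  \<open>w\<close> translates by \<open>n\<close>. By the rearrangement inequality such a step does not increase the Euclidean
  distance of two states, and preserves it only if both are sorted by the same permutation.

  Uniqueness: for two states translated by \<open>w\<close> all sorting permutations agree, so their difference
  is constant on the cycles of the composite permutation, of which there is only one since \<open>m\<close> and
  \<open>n\<close> are coprime. Existence: the parking condition keeps the orbit of any integral state under
  repetitions of \<open>w\<close> bounded up to translation, so it recurs; the average over the recurrence
  period is translated by \<open>w\<close>, and the single cycle makes its entries integral up to a common shift
  and pairwise incongruent modulo \<open>m\<close>. Conversely, the sum of the \<open>i\<close> lowest entries grows by \<open>i n\<close>
  along a tuple and by at most \<open>m\<close> at each letter below \<open>i\<close>, which is the parking condition.\<close>

section \<open>Sorted states and jumps\<close>

text \<open>By induction on \<open>m\<close>: if \<open>\<rho>\<close> moves the top index,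
  exchanging two of its values so that the top becomes fixed strictly raises the sum. The strictness
  gives the equality case.\<close>

lemma rearrangement_strict:
  fixes X Y :: "nat \<Rightarrow> int"
  assumes "strict_mono_on {..<m} X" "strict_mono_on {..<m} Y" "\<rho> permutes {..<m}"
  shows "(\<Sum>j<m. X j * Y (\<rho> j)) \<le> (\<Sum>j<m. X j * Y j) \<and>
    ((\<Sum>j<m. X j * Y (\<rho> j)) = (\<Sum>j<m. X j * Y j) \<longrightarrow> \<rho> = id)"
  using assms
proof (induction m arbitrary: \<rho>)
  case 0
  then show ?case by simp
next
  case (Suc m)
  have mono: "strict_mono_on {..<m} X" "strict_mono_on {..<m} Y"
    using Suc.prems(1,2) by (auto simp: strict_mono_on_def)
  show ?case
  proof (cases "\<rho> m = m")
    case True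
    have "\<rho> permutes {..<m}"
      by (rule permutes_superset[OF Suc.prems(3)]) (use True in \<open>auto simp: less_Suc_eq\<close>)
    from Suc.IH[OF mono this] True show ?thesis by simp
  next
    case False
    define i where "i = inv \<rho> m"
    have bij: "bij \<rho>" using Suc.prems(3) by (rule permutes_bij)
    have \<rho>i: "\<rho> i = m" unfolding i_def using permutes_inverses(1)[OF Suc.prems(3)] by simp
    have "i < Suc m" using permutes_in_image[OF Suc.prems(3), of i] \<rho>i by simp
    moreover have "i \<noteq> m" using \<rho>i False by auto
    ultimately have im: "i < m" by simp
    have "\<rho> m < Suc m" using permutes_in_image[OF Suc.prems(3), of m] by simp
    then have rm: "\<rho> m < m" using False by simp
    define \<rho>' where "\<rho>' = Transposition.transpose m (\<rho> m) \<circ> \<rho>"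
    have "\<rho>' permutes {..<Suc m}" unfolding \<rho>'_def
      by (rule permutes_compose[OF Suc.prems(3)], rule permutes_swap_id) (use rm in auto)
    then have p': "\<rho>' permutes {..<m}"
      by (rule permutes_superset) (auto simp: \<rho>'_def less_Suc_eq)
    have \<rho>'i: "\<rho>' i = \<rho> m" by (simp add: \<rho>'_def \<rho>i)
    have \<rho>'o: "\<rho>' j = \<rho> j" if "j < m" "j \<noteq> i" for j
    proof -
      have "\<rho> j \<noteq> m" "\<rho> j \<noteq> \<rho> m" using that \<rho>i bij by (auto dest!: bij_is_inj injD)
      then show ?thesis by (simp add: \<rho>'_def transpose_def)
    qed
    have "(\<Sum>j<m. X j * Y (\<rho>' j)) \<le> (\<Sum>j<m. X j * Y j)"
      using Suc.IH[OF mono p'] by simp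
    moreover have "(\<Sum>j<m. X j * Y (\<rho>' j)) = X i * Y (\<rho> m) + (\<Sum>j\<in>{..<m}-{i}. X j * Y (\<rho> j))"
      using im \<rho>'o by (simp add: sum.remove[of "{..<m}" i] \<rho>'i)
    moreover have "(\<Sum>j<m. X j * Y (\<rho> j)) = X i * Y m + (\<Sum>j\<in>{..<m}-{i}. X j * Y (\<rho> j))"
      using im by (simp add: sum.remove[of "{..<m}" i] \<rho>i)
    \<comment> \<open>The exchange raises the sum by exactly this product.\<close>
    moreover have "0 < (X m - X i) * (Y m - Y (\<rho> m))"
      using im rm Suc.prems(1,2) by (intro mult_pos_pos) (auto simp: strict_mono_on_def)
    ultimately have "(\<Sum>j<Suc m. X j * Y (\<rho> j)) < (\<Sum>j<Suc m. X j * Y j)"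
      by (simp add: algebra_simps)
    then show ?thesis by simp
  qed
qed

text \<open>The permutation is a parameter because rigidity compares the permutations of two jumps;
  as both fix everything outside the range, they can be compared as functions. The increment is
  general since summing over \<open>K\<close> periods turns \<open>m\<close> into
  \<open>K m\<close>.\<close>

definition jump ::
  "nat \<Rightarrow> int \<Rightarrow> nat \<Rightarrow> (nat \<Rightarrow> nat) \<Rightarrow> (nat \<Rightarrow> int) \<Rightarrow> (nat \<Rightarrow> int) \<Rightarrow> bool" where
  "jump m c k \<tau> X Y \<longleftrightarrow>
     \<tau> permutes {..<m} \<and> strict_mono_on {..<m} X \<and> strict_mono_on {..<m} Y \<and>
     (\<forall>j<m. Y (\<tau> j) = X j + (if j = k then c else 0))"

lemma jump_diff_const:
  "jump m c k \<tau> X Y \<Longrightarrow> jump m c k \<tau> (\<lambda>j. X j - d) (\<lambda>j. Y j - d)"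
  by (auto simp: jump_def strict_mono_on_def)

text \<open>Raising the same entry in both states leaves their differences unchanged, so only the
  sorting can change the distance. Sorting affects only the cross term, to which the rearrangement
  inequality applies.\<close>

lemma jump_cost:
  assumes "jump m c k \<tau> X X'" "jump m c k \<tau>' Y Y'"
  shows "(\<Sum>j<m. (X' j - Y' j)\<^sup>2) \<le> (\<Sum>j<m. (X j - Y j)\<^sup>2)"
    and "(\<Sum>j<m. (X' j - Y' j)\<^sup>2) = (\<Sum>j<m. (X j - Y j)\<^sup>2) \<Longrightarrow> \<tau> = \<tau>'"
proof -
  have \<tau>: "\<tau> permutes {..<m}" and \<tau>': "\<tau>' permutes {..<m}"
    and mX: "strict_mono_on {..<m} X'" and mY: "strict_mono_on {..<m} Y'"
    using assms by (auto simp: jump_def)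
  \<comment> \<open>\<open>\<rho>\<close> pairs each position of \<open>X'\<close> with the position
    of \<open>Y'\<close> that came from the same index.\<close>
  define \<rho> where "\<rho> = \<tau>' \<circ> inv \<tau>"
  have \<rho>: "\<rho> permutes {..<m}"
    unfolding \<rho>_def by (intro permutes_compose permutes_inv \<tau> \<tau>')
  have "(\<Sum>j<m. (X j - Y j)\<^sup>2) = (\<Sum>j<m. (X' (\<tau> j) - Y' (\<rho> (\<tau> j)))\<^sup>2)"
    using assms by (intro sum.cong) (auto simp: jump_def \<rho>_def permutes_inverses(2)[OF \<tau>])
  also have "\<dots> = (\<Sum>i<m. (X' i - Y' (\<rho> i))\<^sup>2)"
    using sum.permute[OF \<tau>, of "\<lambda>i. (X' i - Y' (\<rho> i))\<^sup>2"] by (simp add: comp_def)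
  also have "\<dots> = (\<Sum>i<m. (X' i)\<^sup>2) + (\<Sum>i<m. (Y' (\<rho> i))\<^sup>2) - 2 * (\<Sum>i<m. X' i * Y' (\<rho> i))"
    by (simp add: power2_diff sum.distrib sum_subtractf sum_distrib_left mult.assoc)
  also have "(\<Sum>i<m. (Y' (\<rho> i))\<^sup>2) = (\<Sum>i<m. (Y' i)\<^sup>2)"
    using sum.permute[OF \<rho>, of "\<lambda>i. (Y' i)\<^sup>2"] by (simp add: comp_def)
  finally have a: "(\<Sum>j<m. (X j - Y j)\<^sup>2) =
    (\<Sum>i<m. (X' i)\<^sup>2) + (\<Sum>i<m. (Y' i)\<^sup>2) - 2 * (\<Sum>i<m. X' i * Y' (\<rho> i))" .
  have b: "(\<Sum>j<m. (X' j - Y' j)\<^sup>2) =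
    (\<Sum>i<m. (X' i)\<^sup>2) + (\<Sum>i<m. (Y' i)\<^sup>2) - 2 * (\<Sum>i<m. X' i * Y' i)"
    by (simp add: power2_diff sum.distrib sum_subtractf sum_distrib_left mult.assoc)
  note R = rearrangement_strict[OF mX mY \<rho>]
  show "(\<Sum>j<m. (X' j - Y' j)\<^sup>2) \<le> (\<Sum>j<m. (X j - Y j)\<^sup>2)"
    using R a b by linarith
  assume "(\<Sum>j<m. (X' j - Y' j)\<^sup>2) = (\<Sum>j<m. (X j - Y j)\<^sup>2)"
  then have "\<rho> = id" using R a b by linarith
  then show "\<tau> = \<tau>'"
    unfolding \<rho>_def by (metis comp_assoc comp_id id_comp permutes_inv_o(2)[OF \<tau>])
qed

section \<open>Sums of the lowest entries under a jump\<close>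

lemma sum_initial_le:
  fixes Y :: "nat \<Rightarrow> int"
  assumes "strict_mono_on {..<m} Y" "T \<subseteq> {..<m}"
  shows "sum Y {..<card T} \<le> sum Y T"
  using assms(2)
proof (induction "card T" arbitrary: T)
  case 0
  then have "T = {}" by (metis card_0_eq finite_lessThan finite_subset)
  then show ?case by simp
next
  case (Suc i)
  have fin: "finite T" using Suc.prems finite_subset by blast
  have ne: "T \<noteq> {}" using Suc.hyps(2) by auto
  \<comment> \<open>The largest element of \<open>T\<close> is at least \<open>i\<close>, so its
    entry dominates \<open>Y i\<close>; the rest of \<open>T\<close> is left to the
    induction.\<close>
  define t where "t = Max T"
  have t: "t \<in> T" using fin ne by (simp add: t_def)
  have "T \<subseteq> {..t}" using fin by (auto simp: t_def)
  then have "card T \<le> Suc t" using card_mono[of "{..t}" T] by simp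
  then have it: "i \<le> t" using Suc.hyps(2) by simp
  have "t < m" using t Suc.prems by auto
  then have "Y i \<le> Y t"
    using it assms(1) by (cases "i = t") (auto simp: strict_mono_on_def intro: less_imp_le)
  moreover have c: "card (T - {t}) = i" using Suc.hyps(2) t fin by simp
  have "sum Y {..<i} \<le> sum Y (T - {t})"
    using Suc.hyps(1)[OF c[symmetric]] Suc.prems c by auto
  moreover have "sum Y T = Y t + sum Y (T - {t})" using fin t by (simp add: sum.remove)
  moreover have "sum Y {..<card T} = sum Y {..<i} + Y i" using Suc.hyps(2)[symmetric] by simp
  ultimately show ?case by linarith
qed

lemma jump_image_sum:
  assumes "jump m c k \<tau> X Y" "T \<subseteq> {..<m}"
  shows "sum Y (\<tau> ` T) = sum X T + (if k \<in> T then c else 0)"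
proof -
  have fin: "finite T" using assms(2) finite_subset by blast
  have inj: "inj_on \<tau> T"
    using assms(1) by (auto simp: jump_def dest: permutes_inj intro: inj_on_subset)
  have "sum Y (\<tau> ` T) = (\<Sum>j\<in>T. X j + (if j = k then c else 0))"
    using assms by (subst sum.reindex[OF inj]) (auto simp: jump_def intro!: sum.cong)
  then show ?thesis using fin by (simp add: sum.distrib)
qed

text \<open>The \<open>i\<close> lowest indices are sent to some \<open>i\<close> positions whose
  sum is known, and no \<open>i\<close> positions have a smaller sum than the initial ones.\<close>

lemma jump_sum_upper:
  assumes "jump m c k \<tau> X Y" "i \<le> m"
  shows "sum Y {..<i} \<le> sum X {..<i} + (if k < i then c else 0)"
proof -
  have \<tau>: "\<tau> permutes {..<m}" using assms(1) by (simp add: jump_def)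
  have "card (\<tau> ` {..<i}) = i" using \<tau> by (simp add: card_image permutes_inj_on)
  moreover have "\<tau> ` {..<i} \<subseteq> {..<m}" using permutes_image[OF \<tau>] assms(2) by auto
  ultimately have "sum Y {..<i} \<le> sum Y (\<tau> ` {..<i})"
    using sum_initial_le[of m Y "\<tau> ` {..<i}"] assms(1) by (simp add: jump_def)
  then show ?thesis using jump_image_sum[OF assms(1), of "{..<i}"] assms(2) by simp
qed

text \<open>The same comparison, made in \<open>X\<close> for the indices from which the
  \<open>i\<close> lowest entries of \<open>Y\<close> come.\<close>

lemma jump_sum_lower:
  assumes "jump m c k \<tau> X Y" "i \<le> m" "0 \<le> c"
  shows "sum X {..<i} \<le> sum Y {..<i}"
proof -
  have \<tau>: "\<tau> permutes {..<m}" using assms(1) by (simp add: jump_def)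
  define T where "T = inv \<tau> ` {..<i}"
  have \<tau>': "inv \<tau> permutes {..<m}" using \<tau> by (rule permutes_inv)
  have "card T = i" unfolding T_def using \<tau>' by (simp add: card_image permutes_inj_on)
  moreover have T: "T \<subseteq> {..<m}" unfolding T_def using permutes_image[OF \<tau>'] assms(2) by auto
  ultimately have "sum X {..<i} \<le> sum X T"
    using sum_initial_le[of m X T] assms(1) by (simp add: jump_def)
  moreover have "\<tau> ` T = {..<i}"
    unfolding T_def by (simp add: image_image permutes_inverses(1)[OF \<tau>])
  ultimately show ?thesis using jump_image_sum[OF assms(1) T] assms(3) by (auto split: if_splits)
qed

lemma jump_sum_total:
  assumes "jump m c k \<tau> X Y" "k < m"
  shows "sum Y {..<m} = sum X {..<m} + c"
  using jump_image_sum[OF assms(1), of "{..<m}"] assms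
  by (simp add: jump_def permutes_image)

text \<open>A gap above \<open>c\<close> cannot be crossed by one increment, so the \<open>i\<close>
  lowest entries stay the lowest, the bound of \<open>jump_sum_upper\<close> is attained, and the
  gap shrinks by at most \<open>c\<close>.\<close>

lemma jump_gap:
  assumes J: "jump m c k \<tau> X Y" and i: "0 < i" "i < m" and c: "0 \<le> c"
    and gap: "c < X i - X (i - 1)"
  shows "sum Y {..<i} = sum X {..<i} + (if k < i then c else 0)"
    and "X i - X (i - 1) - c \<le> Y i - Y (i - 1)"
proof -
  have \<tau>: "\<tau> permutes {..<m}"
    and mX: "strict_mono_on {..<m} X" and mY: "strict_mono_on {..<m} Y"
    and Y: "\<And>j. j < m \<Longrightarrow> Y (\<tau> j) = X j + (if j = k then c else 0)"
    using J by (auto simp: jump_def)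
  have \<tau>m: "\<tau> j < m \<longleftrightarrow> j < m" for j using permutes_in_image[OF \<tau>, of j] by simp
  have lo: "Y (\<tau> j) \<le> X (i - 1) + c" if "j < i" for j
  proof -
    have "X j \<le> X (i - 1)"
      using that i by (intro strict_mono_on_leD[OF mX]) auto
    then show ?thesis using that i c by (auto simp: Y)
  qed
  have hi: "X i \<le> Y (\<tau> j)" if "i \<le> j" "j < m" for j
  proof -
    have "X i \<le> X j"
      using that i by (intro strict_mono_on_leD[OF mX]) auto
    then show ?thesis using that c Y[OF that(2)] by (auto split: if_splits)
  qed
  have sep: "\<tau> j < \<tau> j'" if "j < i" "i \<le> j'" "j' < m" for j j'
  proof (rule ccontr)
    assume "\<not> \<tau> j < \<tau> j'"
    then have "Y (\<tau> j') \<le> Y (\<tau> j)"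
      using that i \<tau>m by (intro strict_mono_on_leD[OF mY]) auto
    then show False using lo[OF that(1)] hi[OF that(2,3)] gap by linarith
  qed
  have low: "\<tau> j < i" if "j < i" for j
  proof -
    \<comment> \<open>All \<open>m - i\<close> upper entries land strictly above
      \<open>\<tau> j\<close>, which is possible only if \<open>\<tau> j\<close> is below
      \<open>i\<close>.\<close>
    have "\<tau> ` {i..<m} \<subseteq> {\<tau> j<..<m}" using sep that \<tau>m by auto
    then have "card (\<tau> ` {i..<m}) \<le> card {\<tau> j<..<m}" by (rule card_mono[rotated]) simp
    moreover have "card (\<tau> ` {i..<m}) = m - i" using \<tau> by (simp add: card_image permutes_inj_on)
    ultimately show ?thesis using i \<tau>m[of j] that by simp
  qed
  have "card (\<tau> ` {..<i}) = i" using \<tau> by (simp add: card_image permutes_inj_on)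
  then have im: "\<tau> ` {..<i} = {..<i}" using low by (intro card_subset_eq) auto
  then show "sum Y {..<i} = sum X {..<i} + (if k < i then c else 0)"
    using jump_image_sum[OF J, of "{..<i}"] i by simp
  from im i obtain j where j: "j < i" "\<tau> j = i - 1"
    by (metis diff_less imageE lessThan_iff zero_less_one)
  obtain j' where j': "\<tau> j' = i" using permutes_inverses(1)[OF \<tau>] by metis
  then have "j' < m" using \<tau>m i by metis
  moreover have "i \<le> j'" using low[of j'] j' by (meson leI less_irrefl)
  ultimately show "X i - X (i - 1) - c \<le> Y i - Y (i - 1)"
    using lo[OF j(1)] hi[of j'] j(2) j' by simp
qed

lemma jump_exists:
  fixes X :: "nat \<Rightarrow> int"
  assumes "strict_mono_on {..<m} X"
    and "inj_on (\<lambda>j. X j + (if j = k then c else 0)) {..<m}"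
  obtains \<tau> Y where "jump m c k \<tau> X Y"
proof -
  define g where "g j = X j + (if j = k then c else 0)" for j
  have inj: "inj_on g {..<m}" using assms(2) by (simp add: g_def[abs_def])
  \<comment> \<open>The number of smaller values is the position after sorting. Outside the range
    \<open>r\<close> is the identity, as \<open>permutes\<close> demands.\<close>
  define r where "r j = (if j < m then card {i. i < m \<and> g i < g j} else j)" for j
  have less: "r i < r j" if "i < m" "j < m" "g i < g j" for i j
  proof -
    have "{l. l < m \<and> g l < g i} \<subset> {l. l < m \<and> g l < g j}"
      using that by (auto intro: less_trans)
    then show ?thesis using that by (simp add: r_def psubset_card_mono)
  qed
  have rinj: "inj_on r {..<m}"
  proof (rule inj_onI)
    fix x y assume xy: "x \<in> {..<m}" "y \<in> {..<m}" "r x = r y"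
    then have "g x = g y"
      using less[of x y] less[of y x] by (cases "g x" "g y" rule: linorder_cases) auto
    then show "x = y" using xy inj by (auto dest: inj_onD)
  qed
  have "r j < m" if "j < m" for j
  proof -
    have "{i. i < m \<and> g i < g j} \<subset> {..<m}" using that by auto
    then show ?thesis using that psubset_card_mono[of "{..<m}"] by (simp add: r_def)
  qed
  then have "r ` {..<m} = {..<m}"
    using rinj by (intro card_subset_eq) (auto simp: card_image)
  then have \<tau>: "r permutes {..<m}"
    using rinj by (intro bij_imp_permutes) (auto simp: bij_betw_def r_def)
  define Y where "Y = g \<circ> inv r"
  have "strict_mono_on {..<m} Y"
  proof (rule strict_mono_onI)
    fix a b assume ab: "a \<in> {..<m}" "b \<in> {..<m}" "a < b"
    have "inv r a < m" "inv r b < m"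
      using ab permutes_in_image[OF permutes_inv[OF \<tau>]] by auto
    moreover have "r (inv r a) = a" "r (inv r b) = b" using permutes_inverses(1)[OF \<tau>] by auto
    moreover from calculation have "g (inv r a) \<noteq> g (inv r b)"
      using inj ab(3) by (metis inj_onD lessThan_iff less_irrefl)
    ultimately show "Y a < Y b"
      using less[of "inv r b" "inv r a"] ab(3)
      by (cases "g (inv r a)" "g (inv r b)" rule: linorder_cases) (auto simp: Y_def)
  qed
  then have "jump m c k r X Y"
    using \<tau> assms(1) by (simp add: jump_def Y_def permutes_inverses(2)[OF \<tau>] g_def)
  then show ?thesis by (rule that)
qed

section \<open>Sequences of jumps\<close>

primrec path :: "(nat \<Rightarrow> nat \<Rightarrow> nat) \<Rightarrow> nat \<Rightarrow> nat \<Rightarrow> nat" where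
  "path \<tau> 0 j = j"
| "path \<tau> (Suc t) j = \<tau> t (path \<tau> t j)"

definition visits :: "(nat \<Rightarrow> nat \<Rightarrow> nat) \<Rightarrow> (nat \<Rightarrow> nat) \<Rightarrow> nat \<Rightarrow> nat \<Rightarrow> int" where
  "visits \<tau> w t j = (\<Sum>s<t. if path \<tau> s j = w s then 1 else 0)"

text \<open>Following one entry through all sortings yields the relation between a state and its
  image under the composite permutation that \<open>cycle_value\<close> takes as hypothesis.\<close>

lemma jumps_path:
  assumes "\<forall>t<n. jump m c (w t) (\<tau> t) (X t) (X (Suc t))" "j < m" "t \<le> n"
  shows "path \<tau> t j < m \<and> X t (path \<tau> t j) = X 0 j + c * visits \<tau> w t j"
  using assms(3)
proof (induction t)
  case 0
  then show ?case using assms(2) by (simp add: visits_def)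
next
  case (Suc t)
  then have J: "jump m c (w t) (\<tau> t) (X t) (X (Suc t))" and lt: "path \<tau> t j < m"
    using assms(1) by auto
  have "\<tau> t (path \<tau> t j) < m"
    using J lt permutes_in_image[of "\<tau> t" "{..<m}" "path \<tau> t j"] by (simp add: jump_def)
  then show ?case using J lt Suc by (simp add: jump_def visits_def algebra_simps)
qed

lemma jumps_cost_antimono:
  assumes "\<forall>t<n. jump m c (w t) (\<tau> t) (X t) (X (Suc t))"
    and "\<forall>t<n. jump m c (w t) (\<tau>' t) (Y t) (Y (Suc t))"
    and "s \<le> t" "t \<le> n"
  shows "(\<Sum>j<m. (X t j - Y t j)\<^sup>2) \<le> (\<Sum>j<m. (X s j - Y s j)\<^sup>2)"
  using assms(3,4)
proof (induction t rule: dec_induct)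
  case base
  then show ?case by simp
next
  case (step t)
  then show ?case
    using jump_cost(1)[of m c "w t" "\<tau> t" "X t" "X (Suc t)" "\<tau>' t" "Y t" "Y (Suc t)"] assms(1,2)
    by force
qed

text \<open>The distance never increases; if it is not lower at the end than at the start, it is
  constant throughout and the equality case of \<open>jump_cost\<close> holds at every step.\<close>

lemma jumps_locked:
  assumes "\<forall>t<n. jump m c (w t) (\<tau> t) (X t) (X (Suc t))"
    and "\<forall>t<n. jump m c (w t) (\<tau>' t) (Y t) (Y (Suc t))"
    and "(\<Sum>j<m. (X 0 j - Y 0 j)\<^sup>2) \<le> (\<Sum>j<m. (X n j - Y n j)\<^sup>2)"
    and "t < n"
  shows "\<tau> t = \<tau>' t"
proof -
  note mono = jumps_cost_antimono[OF assms(1,2)]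
  have "(\<Sum>j<m. (X (Suc t) j - Y (Suc t) j)\<^sup>2) = (\<Sum>j<m. (X t j - Y t j)\<^sup>2)"
    using mono[of t "Suc t"] mono[of 0 t] mono[of "Suc t" n] assms(3,4) by linarith
  then show ?thesis
    using jump_cost(2)[of m c "w t" "\<tau> t" "X t" "X (Suc t)" "\<tau>' t" "Y t" "Y (Suc t)"] assms(1,2,4)
    by blast
qed

section \<open>Uniqueness\<close>

lemma eq_if_dvd_mult_diff:
  fixes l l' m n :: nat
  assumes "l < m" "l' < m" "coprime m n" "int m dvd int n * (int l - int l')"
  shows "l = l'"
proof -
  have "int m dvd int l - int l'" using assms(3,4) by (simp add: coprime_dvd_mult_right_iff)
  then show ?thesis
    using assms(1,2) zdvd_imp_le[of "int m" "int l - int l'"]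
      zdvd_imp_le[of "int m" "int l' - int l"]
    by (cases l l' rule: linorder_cases) (auto simp: dvd_diff_commute)
qed

text \<open>Each application of \<open>\<sigma>\<close> changes \<open>Z\<close> by \<open>K\<close>
  times a number congruent to \<open>- n\<close> modulo \<open>m\<close>. The factor
  \<open>K\<close> is 1 for uniqueness and the number of periods for a summed orbit.\<close>

lemma cycle_value:
  fixes Z a :: "nat \<Rightarrow> int"
  assumes "\<forall>j<m. \<sigma> j < m" "\<forall>j<m. Z (\<sigma> j) + K * int n = Z j + K * int m * a j" "0 < m"
  shows "(\<sigma> ^^ l) 0 < m \<and> (\<exists>b. Z ((\<sigma> ^^ l) 0) = Z 0 + K * (int m * b - int n * int l))"
proof (induction l)
  case 0
  then show ?case using assms(3) by (auto intro: exI[of _ 0])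
next
  case (Suc l)
  define i where "i = (\<sigma> ^^ l) 0"
  obtain b where b: "Z i = Z 0 + K * (int m * b - int n * int l)" and i: "i < m"
    using Suc by (auto simp: i_def)
  have "Z (\<sigma> i) = Z 0 + K * (int m * (a i + b) - int n * int (Suc l))"
    using assms(2) i b by (simp add: algebra_simps) (smt (verit) i)
  then show ?case using assms(1) i by (auto simp: i_def)
qed

text \<open>Since \<open>\<sigma>\<close> changes the residue of \<open>Z j\<close> by \<open>- n\<close>, a unit modulo \<open>m\<close>, it is a single cycle.\<close>

lemma cycle_transitive:
  fixes Z a :: "nat \<Rightarrow> int"
  assumes \<sigma>: "\<forall>j<m. \<sigma> j < m" and Z: "\<forall>j<m. Z (\<sigma> j) + K * int n = Z j + K * int m * a j"
    and "0 < m" "coprime m n" "K \<noteq> 0" "j < m"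
  shows "\<exists>l<m. j = (\<sigma> ^^ l) 0"
proof -
  note val = cycle_value[OF \<sigma> Z \<open>0 < m\<close>]
  have "inj_on (\<lambda>l. (\<sigma> ^^ l) 0) {..<m}"
  proof (rule inj_onI)
    fix l l' assume l: "l \<in> {..<m}" "l' \<in> {..<m}" and eq: "(\<sigma> ^^ l) 0 = (\<sigma> ^^ l') 0"
    obtain b b' where "Z ((\<sigma> ^^ l) 0) = Z 0 + K * (int m * b - int n * int l)"
      "Z ((\<sigma> ^^ l') 0) = Z 0 + K * (int m * b' - int n * int l')"
      using val by meson
    then have "int m * b - int n * int l = int m * b' - int n * int l'"
      using eq \<open>K \<noteq> 0\<close> by simp
    then have "int n * (int l - int l') = int m * (b - b')" by (simp add: algebra_simps)
    then have "int m dvd int n * (int l - int l')" by simp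
    then show "l = l'" using l \<open>coprime m n\<close> by (intro eq_if_dvd_mult_diff) auto
  qed
  then have "(\<lambda>l. (\<sigma> ^^ l) 0) ` {..<m} = {..<m}"
    using val by (intro card_subset_eq) (auto simp: card_image)
  then show ?thesis using \<open>j < m\<close> by (auto simp: set_eq_iff image_iff Bex_def)
qed

lemma jumps_cycle_unique:
  assumes X: "\<forall>t<n. jump m (int m) (w t) (\<tau> t) (X t) (X (Suc t))"
    and Y: "\<forall>t<n. jump m (int m) (w t) (\<tau>' t) (Y t) (Y (Suc t))"
    and Xn: "\<forall>j<m. X n j = X 0 j + int n" and Yn: "\<forall>j<m. Y n j = Y 0 j + int n"
    and "coprime m n" "0 < m" "X 0 0 = Y 0 0" "j < m"
  shows "X 0 j = Y 0 j"
proof -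
  \<comment> \<open>Both states are translated by \<open>n\<close>, so their distance is the same at
    both ends.\<close>
  have "\<tau> t = \<tau>' t" if "t < n" for t
    by (rule jumps_locked[OF X Y _ that]) (use Xn Yn in simp)
  then have Y': "\<forall>t<n. jump m (int m) (w t) (\<tau> t) (Y t) (Y (Suc t))" using Y by auto
  define \<sigma> where "\<sigma> = path \<tau> n"
  have \<sigma>: "\<forall>j<m. \<sigma> j < m" using jumps_path[OF X] by (simp add: \<sigma>_def)
  have sX: "\<forall>j<m. X 0 (\<sigma> j) + 1 * int n = X 0 j + 1 * int m * visits \<tau> w n j"
    using jumps_path[OF X, of _ n] Xn \<sigma> by (fastforce simp: \<sigma>_def)
  have sY: "\<forall>j<m. Y 0 (\<sigma> j) + 1 * int n = Y 0 j + 1 * int m * visits \<tau> w n j"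
    using jumps_path[OF Y', of _ n] Yn \<sigma> by (fastforce simp: \<sigma>_def)
  \<comment> \<open>The visit counts depend only on the permutations and the word, so
    \<open>X 0\<close> and \<open>Y 0\<close> change equally under \<open>\<sigma>\<close> and agree
    along the orbit of 0.\<close>
  have "(\<sigma> ^^ l) 0 < m \<and> X 0 ((\<sigma> ^^ l) 0) = Y 0 ((\<sigma> ^^ l) 0)" for l
  proof (induction l)
    case (Suc l)
    then show ?case using \<sigma> sX sY by (smt (verit) comp_apply funpow.simps(2))
  qed (use assms in auto)
  then show ?thesis
    using cycle_transitive[OF \<sigma> sX \<open>0 < m\<close> \<open>coprime m n\<close> _ \<open>j < m\<close>] by auto
qed

section \<open>Partial sums along a sequence of jumps, and orbits of an integral state\<close>

lemma card_less_Suc: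
  "card {s. s < Suc t \<and> P s} = card {s. s < t \<and> P s} + (if P t then 1 else 0)"
proof -
  have "{s. s < Suc t \<and> P s} = (if P t then insert t {s. s < t \<and> P s} else {s. s < t \<and> P s})"
    by (auto simp: less_Suc_eq)
  then show ?thesis by simp
qed

lemma jumps_sum_upper:
  assumes "\<forall>t<n. jump m c (w t) (\<tau> t) (X t) (X (Suc t))" "i \<le> m" "t \<le> n"
  shows "sum (X t) {..<i} \<le> sum (X 0) {..<i} + c * int (card {s. s < t \<and> w s < i})"
  using assms(3)
proof (induction t)
  case (Suc t)
  then have "sum (X (Suc t)) {..<i} \<le> sum (X t) {..<i} + (if w t < i then c else 0)"
    using assms(1,2) by (intro jump_sum_upper[where \<tau> = "\<tau> t"]) auto
  then show ?case using Suc by (auto simp: card_less_Suc[of t "\<lambda>s. w s < i"] algebra_simps)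
qed simp

lemma jumps_sum_lower:
  assumes "\<forall>t<n. jump m c (w t) (\<tau> t) (X t) (X (Suc t))" "i \<le> m" "0 \<le> c" "t \<le> n"
  shows "sum (X 0) {..<i} \<le> sum (X t) {..<i}"
  using assms(4)
proof (induction t)
  case (Suc t)
  then have "sum (X t) {..<i} \<le> sum (X (Suc t)) {..<i}"
    using assms(1,2,3) by (intro jump_sum_lower[where \<tau> = "\<tau> t" and k = "w t"]) auto
  then show ?case using Suc by simp
qed simp

lemma jumps_sum_total:
  assumes "\<forall>t<n. jump m c (w t) (\<tau> t) (X t) (X (Suc t))" "\<forall>t<n. w t < m" "t \<le> n"
  shows "sum (X t) {..<m} = sum (X 0) {..<m} + c * int t"
  using assms(3)
proof (induction t)
  case (Suc t)
  then have "sum (X (Suc t)) {..<m} = sum (X t) {..<m} + c"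
    using assms(1,2) by (intro jump_sum_total[where \<tau> = "\<tau> t" and k = "w t"]) auto
  then show ?case using Suc by (simp add: algebra_simps)
qed simp

text \<open>The initial gap exceeds \<open>c n\<close> and each jump costs at most \<open>c\<close>,
  so every one of the \<open>n\<close> jumps starts from a gap above \<open>c\<close> and
  \<open>jump_gap\<close> applies to it.\<close>

lemma jumps_gap:
  assumes "\<forall>t<n. jump m c (w t) (\<tau> t) (X t) (X (Suc t))" "0 < i" "i < m" "0 \<le> c"
    and gap: "c * int n < X 0 i - X 0 (i - 1)" and "t \<le> n"
  shows "sum (X t) {..<i} = sum (X 0) {..<i} + c * int (card {s. s < t \<and> w s < i}) \<and>
    X 0 i - X 0 (i - 1) - c * int t \<le> X t i - X t (i - 1)"
  using assms(6)
proof (induction t)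
  case (Suc t)
  have J: "jump m c (w t) (\<tau> t) (X t) (X (Suc t))" using assms(1) Suc.prems by simp
  have IH: "sum (X t) {..<i} = sum (X 0) {..<i} + c * int (card {s. s < t \<and> w s < i})"
    "X 0 i - X 0 (i - 1) - c * int t \<le> X t i - X t (i - 1)" using Suc by auto
  have "c * int (Suc t) \<le> c * int n" using Suc.prems assms(4) by (intro mult_left_mono) auto
  then have "c < X t i - X t (i - 1)" using IH(2) gap by (simp add: algebra_simps)
  from jump_gap[OF J assms(2-4) this] IH show ?case
    by (auto simp: card_less_Suc[of t "\<lambda>s. w s < i"] algebra_simps)
qed simp

text \<open>The entries are pairwise incongruent modulo \<open>m\<close> at the start, and raising
  one by \<open>m\<close> preserves this. So a raised entry never meets another one and the next
  state exists.\<close>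

lemma jumps_exists:
  assumes "0 < m"
  obtains X \<tau> where "X 0 = int" "\<forall>t. jump m (int m) (w t) (\<tau> t) (X t) (X (Suc t))"
proof -
  define R where "R Y \<longleftrightarrow> (\<forall>i<m. \<forall>j<m. int m dvd Y i - Y j \<longrightarrow> i = j)" for Y :: "nat \<Rightarrow> int"
  define P where "P t Y \<longleftrightarrow> strict_mono_on {..<m} Y \<and> R Y \<and> (t = 0 \<longrightarrow> Y = int)"
    for t :: nat and Y
  have "\<exists>X. \<forall>t. P t (X t) \<and> (\<exists>\<tau>. jump m (int m) (w t) \<tau> (X t) (X (Suc t)))"
  proof (rule dependent_nat_choice)
    have "i = j" if "i < m" "j < m" "int m dvd int i - int j" for i j
      using eq_if_dvd_mult_diff[of i m j 1] that by simp
    then show "\<exists>X. P 0 X" by (auto simp: P_def R_def strict_mono_on_def)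
  next
    fix X t assume P: "P t X"
    have inj: "inj_on (\<lambda>j. X j + (if j = w t then int m else 0)) {..<m}"
    proof (rule inj_onI)
      fix i j assume ij: "i \<in> {..<m}" "j \<in> {..<m}"
        and "X i + (if i = w t then int m else 0) = X j + (if j = w t then int m else 0)"
      then have "X i - X j = int m * ((if j = w t then 1 else 0) - (if i = w t then 1 else 0))"
        by (auto split: if_splits)
      then have "int m dvd X i - X j" by (rule dvdI)
      then show "i = j" using P ij by (auto simp: P_def R_def)
    qed
    obtain \<tau> Y where J: "jump m (int m) (w t) \<tau> X Y"
      using jump_exists[OF _ inj] P by (auto simp: P_def)
    have "R Y" unfolding R_def
    proof (intro allI impI)
      fix i j assume ij: "i < m" "j < m" and dvd: "int m dvd Y i - Y j"
      have \<tau>: "\<tau> permutes {..<m}" using J by (simp add: jump_def)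
      obtain i' j' where i': "i = \<tau> i'" "j = \<tau> j'" using permutes_inverses(1)[OF \<tau>] by metis
      then have lt: "i' < m" "j' < m" using ij permutes_in_image[OF \<tau>] by auto
      have "X i' - X j' = (Y i - Y j) + int m * ((if j' = w t then 1 else 0) - (if i' = w t then 1 else 0))"
        using J lt i' by (auto simp: jump_def)
      then have "int m dvd X i' - X j'" using dvd by simp
      then show "i = j" using P lt i' by (auto simp: P_def R_def)
    qed
    then show "\<exists>Y. P (Suc t) Y \<and> (\<exists>\<tau>. jump m (int m) (w t) \<tau> X Y)"
      using J by (auto simp: P_def jump_def intro!: exI[of _ Y] exI[of _ \<tau>])
  qed
  then obtain X where X: "\<forall>t. P t (X t)" "\<forall>t. \<exists>\<tau>. jump m (int m) (w t) \<tau> (X t) (X (Suc t))"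
    by blast
  then obtain \<tau> where "\<forall>t. jump m (int m) (w t) (\<tau> t) (X t) (X (Suc t))" by metis
  moreover have "X 0 = int" using X(1) by (simp add: P_def)
  ultimately show ?thesis using that by blast
qed

section \<open>Recurrence and existence\<close>

text \<open>If the gap above the \<open>i\<close> lowest entries exceeds \<open>m n\<close>, the parking condition keeps their
  sum, corrected by the drift, from decreasing during a period; otherwise the sum for \<open>i\<close> is almost
  at least the mean of those for \<open>i - 1\<close> and \<open>i + 1\<close>. Hence a sufficiently convex lower bound is
  preserved.\<close>

lemma jumps_sum_bounded_below:
  assumes J: "\<forall>t. jump m (int m) (w t) (\<tau> t) (X t) (X (Suc t))" and X0: "X 0 = int"
    and w: "\<forall>t. w t < m"
    and park: "\<forall>s i. 0 < i \<and> i < m \<longrightarrow> i * n \<le> m * card {t. t < n \<and> w (s * n + t) < i}"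
    and "i \<le> m"
  shows "2 * int m * int n * ((int i)\<^sup>2 - (int m)\<^sup>2) \<le> sum (X (s * n)) {..<i} - int i * int (s * n)"
  using \<open>i \<le> m\<close>
proof (induction s arbitrary: i)
  case 0
  have "2 * int m * int n * ((int i)\<^sup>2 - (int m)\<^sup>2) \<le> 0"
    using 0 by (intro mult_nonneg_nonpos) (auto intro!: power_mono)
  also have "0 \<le> sum (X 0) {..<i}" by (simp add: X0 sum_nonneg)
  finally show ?case by simp
next
  case (Suc s)
  \<comment> \<open>This quadratic vanishes at \<open>i = m\<close>, is nonpositive for
    \<open>i \<le> m\<close>, and has constant second difference \<open>4 m n\<close>.\<close>
  define h where "h i = 2 * int m * int n * ((int i)\<^sup>2 - (int m)\<^sup>2)" for i
  define S where "S i = sum (X (s * n)) {..<i} - int i * int (s * n)" for i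
  have IH: "h i \<le> S i" if "i \<le> m" for i using Suc.IH[OF that] by (simp add: h_def S_def)
  define X' where "X' t = X (s * n + t)" for t
  have J': "\<forall>t<n. jump m (int m) (w (s * n + t)) (\<tau> (s * n + t)) (X' t) (X' (Suc t))"
    using J by (simp add: X'_def)
  have X': "X' 0 = X (s * n)" "X' n = X (Suc s * n)" by (auto simp: X'_def add.commute)
  define S' where "S' i = sum (X' n) {..<i} - int i * int (Suc s * n)" for i
  consider "i = 0" | "i = m" | "0 < i" "i < m" using Suc.prems by linarith
  then have "h i \<le> S' i"
  proof cases
    case 1
    then show ?thesis by (simp add: h_def S'_def)
  next
    case 2
    \<comment> \<open>Each of the \<open>n\<close> letters of a period adds \<open>m\<close>, so the
      total sum corrected by the drift never changes.\<close>
    have "sum (X (Suc s * n)) {..<m} = sum (X 0) {..<m} + int m * int (Suc s * n)"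
      by (rule jumps_sum_total[of "Suc s * n"]) (use J w in auto)
    then have "S' m = sum (X 0) {..<m}" by (simp only: S'_def X')
    then show ?thesis using 2 by (simp add: h_def X0 sum_nonneg)
  next
    case 3
    show ?thesis
    proof (cases "int m * int n < X' 0 i - X' 0 (i - 1)")
      case True
      have "sum (X' n) {..<i} =
        sum (X' 0) {..<i} + int m * int (card {t. t < n \<and> w (s * n + t) < i})"
        using jumps_gap[OF J' 3 _ True, of n] by simp
      moreover have "int i * int n \<le> int m * int (card {t. t < n \<and> w (s * n + t) < i})"
        using park 3 by (metis of_nat_le_iff of_nat_mult)
      ultimately have "S i \<le> S' i" by (simp add: S_def S'_def X' algebra_simps)
      then show ?thesis using IH[of i] 3 by simp
    next
      case False
      obtain j where j: "i = Suc j" using 3 by (cases i) auto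
      \<comment> \<open>The second difference of \<open>S\<close> at \<open>i\<close> is the gap,
        here at most \<open>m n\<close>. Against \<open>4 m n\<close> for \<open>h\<close> this
        leaves a reserve of \<open>3 m n\<close>, enough for twice the loss \<open>i n\<close> of
        one period.\<close>
      have "S (Suc i) + S j = 2 * S i + (X' 0 i - X' 0 (i - 1))"
        by (simp add: S_def j X' algebra_simps)
      moreover have "h (Suc i) + h j = 2 * h i + 4 * (int m * int n)"
        by (simp add: h_def j power2_eq_square algebra_simps)
      moreover have "h (Suc i) \<le> S (Suc i)" "h j \<le> S j" using IH 3 j by auto
      ultimately have "2 * h i + 3 * (int m * int n) \<le> 2 * S i" using False by linarith
      moreover have "S i - int i * int n \<le> S' i"
        using jumps_sum_lower[OF J' Suc.prems, of n] by (simp add: S_def S'_def X' algebra_simps)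
      moreover have "int i * int n \<le> int m * int n" using 3 by (intro mult_right_mono) auto
      moreover have "0 \<le> int m * int n" by simp
      ultimately show ?thesis by linarith
    qed
  qed
  then show ?case by (simp only: h_def S'_def X')
qed

text \<open>The bound for \<open>i = 1\<close> controls the lowest entry, hence all entries from
  below; the constant corrected total then bounds them from above. Up to translation only finitely
  many states occur at the period ends, so one recurs.\<close>

lemma jumps_recurrent:
  assumes J: "\<forall>t. jump m (int m) (w t) (\<tau> t) (X t) (X (Suc t))" and X0: "X 0 = int"
    and w: "\<forall>t. w t < m"
    and park: "\<forall>s i. 0 < i \<and> i < m \<longrightarrow> i * n \<le> m * card {t. t < n \<and> w (s * n + t) < i}"
  obtains s s' where "s < s'"
    "\<forall>j<m. X (s' * n) j - int (s' * n) = X (s * n) j - int (s * n)"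
proof -
  have m: "0 < m" using w by (metis gr_zeroI not_less_zero)
  \<comment> \<open>\<open>L\<close> weakens the bound for \<open>i = 1\<close>. \<open>U\<close>
    subtracts \<open>L\<close> once more than the other \<open>m - 1\<close> entries require, which
    only enlarges it because \<open>L\<close> is nonpositive.\<close>
  define L where "L = - 2 * int m * int n * (int m)\<^sup>2"
  define U where "U = sum (X 0) {..<m} - int m * L"
  have L: "L \<le> 0" by (simp add: L_def)
  have bnd: "X (s * n) j - int (s * n) \<in> {L..U}" if "j < m" for s j
  proof -
    define Y where "Y j = X (s * n) j - int (s * n)" for j
    have lo: "L \<le> Y i" if "i < m" for i
    proof -
      have "2 * int m * int n * (1 - (int m)\<^sup>2) \<le> Y 0"
        using jumps_sum_bounded_below[OF J X0 w park, of 1 s] m by (simp add: Y_def)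
      moreover have "L \<le> 2 * int m * int n * (1 - (int m)\<^sup>2)"
        by (simp add: L_def algebra_simps)
      moreover have "Y 0 \<le> Y i"
        using J that m strict_mono_on_leD[of "{..<m}" "X (s * n)" 0 i]
        by (simp add: jump_def Y_def)
      ultimately show ?thesis by linarith
    qed
    have "sum (X (s * n)) {..<m} = sum (X 0) {..<m} + int m * int (s * n)"
      by (rule jumps_sum_total[of "s * n"]) (use J w in auto)
    then have "sum Y {..<m} = sum (X 0) {..<m}" by (simp add: Y_def sum_subtractf)
    moreover have "sum Y {..<m} = Y j + sum Y ({..<m} - {j})" using that by (simp add: sum.remove)
    moreover have "(\<Sum>i\<in>{..<m} - {j}. L) \<le> sum Y ({..<m} - {j})" by (intro sum_mono lo) auto
    moreover have "int m * L \<le> (\<Sum>i\<in>{..<m} - {j}. L)"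
      using L that by (simp add: mult_right_mono_neg)
    ultimately show ?thesis using lo[OF that] by (simp add: U_def Y_def)
  qed
  \<comment> \<open>Restriction fixes the values outside the range, so that the states lie in a
    finite function space.\<close>
  define F where "F s = restrict (\<lambda>j. X (s * n) j - int (s * n)) {..<m}" for s
  have "range F \<subseteq> (\<Pi>\<^sub>E j\<in>{..<m}. {L..U})" 
    unfolding F_def image_subset_iff restrict_PiE_iff using bnd by blast
  then have "finite (range F)" by (rule finite_subset) (simp add: finite_PiE)
  then have "\<not> inj F" using finite_imageD infinite_UNIV_nat by blast
  then obtain a b where ab: "a \<noteq> b" "F a = F b" by (auto simp: inj_def)
  have "\<forall>j<m. X (a * n) j - int (a * n) = X (b * n) j - int (b * n)"
    using fun_cong[OF ab(2)] by (simp add: F_def restrict_def) metis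
  then show ?thesis using that[of a b] that[of b a] ab(1) by (metis nat_neq_iff)
qed

text \<open>Summing over the periods of a recurrent orbit: all summands are sorted by the same
  permutations, because the distance between the orbit and its shift by \<open>n\<close> cannot decrease.\<close>

lemma jumps_average:
  assumes J: "\<forall>t. jump m c (w t) (\<tau> t) (X t) (X (Suc t))" and w: "\<forall>t. w (t + n) = w t"
    and per: "\<forall>j<m. X (K * n) j = X 0 j + d" and "0 < K"
  obtains Z where "\<forall>t<n. jump m (int K * c) (w t) (\<tau> t) (Z t) (Z (Suc t))"
    "\<forall>j<m. Z n j = Z 0 j + d"
proof -
  have wK: "w (t + s * n) = w t" for s t
    by (induction s) (use w in \<open>auto simp: algebra_simps, metis add.assoc add.commute\<close>)
  have perK: "X (u + K * n) j = X u j + d" if "j < m" for u j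
  proof -
    \<comment> \<open>The orbit one recurrence later, moved back by \<open>d\<close>, starts at
      distance 0 from the orbit and therefore stays equal to it.\<close>
    define Y where "Y t j = X (t + K * n) j - d" for t j
    have "\<forall>t. jump m c (w (t + K * n)) (\<tau> (t + K * n)) (Y t) (Y (Suc t))"
      unfolding Y_def using J by (auto intro!: jump_diff_const)
    then have "\<forall>t. jump m c (w t) (\<tau> (t + K * n)) (Y t) (Y (Suc t))" by (simp add: wK)
    then have "(\<Sum>j<m. (X u j - Y u j)\<^sup>2) \<le> (\<Sum>j<m. (X 0 j - Y 0 j)\<^sup>2)"
      using J by (intro jumps_cost_antimono[of u m c w \<tau> X "\<lambda>t. \<tau> (t + K * n)" Y]) auto
    also have "\<dots> = 0" using per by (simp add: Y_def)
    finally have "(\<Sum>j<m. (X u j - Y u j)\<^sup>2) = 0" by (simp add: antisym sum_nonneg)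
    then have "X u j - Y u j = 0" using that by (simp add: sum_nonneg_eq_0_iff)
    then show ?thesis by (simp add: Y_def)
  qed
  have lock: "\<tau> (u + n) = \<tau> u" if "u < K * n" for u
  proof -
    have "\<forall>t<K * n. jump m c (w t) (\<tau> t) (X t) (X (Suc t))" using J by simp
    moreover have "\<forall>t<K * n. jump m c (w t) (\<tau> (t + n)) (X (t + n)) (X (Suc t + n))"
      using J w by (metis add_Suc)
    moreover have "(\<Sum>j<m. (X 0 j - X (0 + n) j)\<^sup>2)
      \<le> (\<Sum>j<m. (X (K * n) j - X (K * n + n) j)\<^sup>2)"
      using perK[of _ n] per by (simp add: add.commute)
    ultimately show ?thesis
      using that jumps_locked[of "K * n" m c w \<tau> X "\<lambda>t. \<tau> (t + n)" "\<lambda>t. X (t + n)" u] by simp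
  qed
  have lockK: "\<tau> (s * n + t) = \<tau> t" if "s < K" "t < n" for s t
    using that
  proof (induction s)
    case (Suc s)
    have "s * n + t < Suc s * n" using Suc.prems by simp
    also have "\<dots> \<le> K * n" using Suc.prems by (intro mult_right_mono) auto
    finally have "\<tau> (s * n + t + n) = \<tau> (s * n + t)" by (rule lock)
    then show ?case using Suc by (simp add: algebra_simps)
  qed simp
  \<comment> \<open>The sum is \<open>K\<close> times the average and stays integral, at the price
    of the increment \<open>K c\<close>.\<close>
  define Z where "Z t j = (\<Sum>s<K. X (s * n + t) j)" for t j
  have "jump m (int K * c) (w t) (\<tau> t) (Z t) (Z (Suc t))" if "t < n" for t
    unfolding jump_def
  proof (intro conjI allI impI)
    have mono: "strict_mono_on {..<m} (Z t)" for t
      unfolding Z_def using J \<open>0 < K\<close>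
      by (intro strict_mono_onI sum_strict_mono) (auto simp: jump_def strict_mono_on_def)
    show "strict_mono_on {..<m} (Z t)" "strict_mono_on {..<m} (Z (Suc t))" by (rule mono)+
    show "\<tau> t permutes {..<m}" using J by (simp add: jump_def)
    fix j assume "j < m"
    have "X (s * n + Suc t) (\<tau> t j) = X (s * n + t) j + (if j = w t then c else 0)"
      if "s < K" for s
    proof -
      have "jump m c (w (s * n + t)) (\<tau> (s * n + t)) (X (s * n + t)) (X (Suc (s * n + t)))"
        using J by blast
      then show ?thesis
        using lockK[OF that \<open>t < n\<close>] wK[of t s] \<open>j < m\<close> by (simp add: jump_def add.commute)
    qed
    then have "Z (Suc t) (\<tau> t j) = (\<Sum>s<K. X (s * n + t) j + (if j = w t then c else 0))"
      unfolding Z_def by (intro sum.cong) auto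
    then show "Z (Suc t) (\<tau> t j) = Z t j + (if j = w t then int K * c else 0)"
      by (simp add: Z_def sum.distrib)
  qed
  moreover have "Z n j = Z 0 j + d" if "j < m" for j
  proof -
    \<comment> \<open>The differences telescope: one period moves the sum by as much as
      \<open>K\<close> periods move \<open>X\<close>.\<close>
    have "Z n j - Z 0 j = (\<Sum>s<K. X (Suc s * n) j - X (s * n) j)"
      by (simp add: Z_def sum_subtractf add.commute)
    also have "\<dots> = X (K * n) j - X (0 * n) j"
      by (rule sum_lessThan_telescope)
    finally show ?thesis using per that by simp
  qed
  ultimately show ?thesis using that by blast
qed

lemma jumps_cycle_exists:
  assumes "0 < m" "0 < n" "coprime m n" and w: "\<forall>t. w t < m" "\<forall>t. w (t + n) = w t"
    and park: "\<forall>i. 0 < i \<and> i < m \<longrightarrow> i * n \<le> m * card {t. t < n \<and> w t < i}"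
  obtains V \<tau> where "\<forall>t<n. jump m (int m) (w t) (\<tau> t) (V t) (V (Suc t))"
    "\<forall>j<m. V n j = V 0 j + int n" "V 0 0 = 0"
    "\<forall>i<m. \<forall>j<m. int m dvd V 0 i - V 0 j \<longrightarrow> i = j"
proof -
  have ws: "w (s * n + t) = w t" for s t
    by (induction s) (use w(2) in \<open>auto simp: algebra_simps, metis add.assoc add.commute\<close>)
  obtain X \<rho> where X: "X 0 = int" "\<forall>t. jump m (int m) (w t) (\<rho> t) (X t) (X (Suc t))"
    using jumps_exists[OF \<open>0 < m\<close>] by blast
  obtain s s' where s: "s < s'"
    and eq: "\<forall>j<m. X (s' * n) j - int (s' * n) = X (s * n) j - int (s * n)"
    using jumps_recurrent[OF X(2,1) w(1), of n] park ws by auto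
  define K where "K = s' - s"
  have K: "0 < K" "s' * n = K * n + s * n" using s by (auto simp: K_def algebra_simps)
  \<comment> \<open>Time now starts at the earlier of the two coinciding states; this is a multiple
    of \<open>n\<close>, so the word reads the same.\<close>
  define \<tau> where "\<tau> t = \<rho> (t + s * n)" for t
  have "\<forall>t. jump m (int m) (w t) (\<tau> t) (X (t + s * n)) (X (Suc t + s * n))"
    using X(2) ws by (metis \<tau>_def add.commute add_Suc)
  moreover have "\<forall>j<m. X (K * n + s * n) j = X (0 + s * n) j + int K * int n"
  proof (intro allI impI)
    fix j assume "j < m"
    moreover have "int (s' * n) = int K * int n + int (s * n)" by (simp only: K(2)) simp
    ultimately have "X (s' * n) j = X (s * n) j + int K * int n" using eq by auto
    then show "X (K * n + s * n) j = X (0 + s * n) j + int K * int n" by (simp add: K(2))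
  qed
  ultimately obtain Z
    where Z: "\<forall>t<n. jump m (int K * int m) (w t) (\<tau> t) (Z t) (Z (Suc t))"
      and Zn: "\<forall>j<m. Z n j = Z 0 j + int K * int n"
    using jumps_average[of m "int m" w \<tau> "\<lambda>t. X (t + s * n)" n K "int K * int n"] w(2) K(1) by blast
  define \<sigma> where "\<sigma> = path \<tau> n"
  have \<sigma>: "\<forall>j<m. \<sigma> j < m" using jumps_path[OF Z] by (simp add: \<sigma>_def)
  have sZ: "\<forall>j<m. Z 0 (\<sigma> j) + int K * int n = Z 0 j + int K * int m * visits \<tau> w n j"
    using jumps_path[OF Z, of _ n] Zn \<sigma> by (fastforce simp: \<sigma>_def)
  note val = cycle_value[OF \<sigma> sZ \<open>0 < m\<close>]
  have orb: "\<exists>l<m. j = (\<sigma> ^^ l) 0" if "j < m" for j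
    using cycle_transitive[OF \<sigma> sZ] assms that K(1) by simp
  \<comment> \<open>At time 0 every entry lies on the cycle of 0, along which
    \<open>cycle_value\<close> changes values by multiples of \<open>K\<close>; the later increments
    are multiples of \<open>K\<close> too.\<close>
  have div: "int K dvd Z t j - Z 0 0" if "t \<le> n" "j < m" for t j
    using that
  proof (induction t arbitrary: j)
    case 0
    then obtain l where "j = (\<sigma> ^^ l) 0" using orb by blast
    then show ?case using val[of l] by auto
  next
    case (Suc t)
    have J: "jump m (int K * int m) (w t) (\<tau> t) (Z t) (Z (Suc t))" using Z Suc.prems by simp
    then have \<tau>: "\<tau> t permutes {..<m}" by (simp add: jump_def)
    obtain i where i: "j = \<tau> t i" using permutes_inverses(1)[OF \<tau>] by metis
    then have "i < m" using Suc.prems permutes_in_image[OF \<tau>] by auto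
    then have "Z (Suc t) j - Z 0 0 = (Z t i - Z 0 0) + int K * (if i = w t then int m else 0)"
      using J i by (simp add: jump_def)
    moreover have "int K dvd Z t i - Z 0 0" using Suc.IH[of i] Suc.prems \<open>i < m\<close> by simp
    ultimately show ?case by (simp only: dvd_add dvd_triv_left)
  qed
  \<comment> \<open>By \<open>div\<close> the division is exact. It turns the increment
    \<open>K m\<close> into \<open>m\<close> and the translation \<open>K n\<close> into
    \<open>n\<close>.\<close>
  define V where "V t j = (Z t j - Z 0 0) div int K" for t j
  have V: "Z t j = Z 0 0 + int K * V t j" if "t \<le> n" "j < m" for t j
    using div[OF that] by (simp add: V_def)
  have "jump m (int m) (w t) (\<tau> t) (V t) (V (Suc t))" if "t < n" for t
  proof -
    have J: "jump m (int K * int m) (w t) (\<tau> t) (Z t) (Z (Suc t))" using Z that by simp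
    have mono: "strict_mono_on {..<m} (V t)" if "strict_mono_on {..<m} (Z t)" "t \<le> n" for t
    proof (rule strict_mono_onI)
      fix i j assume ij: "i \<in> {..<m}" "j \<in> {..<m}" "i < j"
      then have "Z t i < Z t j" by (intro strict_mono_onD[OF that(1)])
      then have "int K * V t i < int K * V t j"
        using V[OF that(2), of i] V[OF that(2), of j] ij by simp
      then show "V t i < V t j" using K(1) by simp
    qed
    have "V (Suc t) (\<tau> t j) = V t j + (if j = w t then int m else 0)" if "j < m" for j
    proof -
      have "\<tau> t j < m"
        using J that permutes_in_image[of "\<tau> t" "{..<m}" j] by (simp add: jump_def)
      moreover have "Z (Suc t) (\<tau> t j) = Z t j + int K * (if j = w t then int m else 0)"
        using J that by (simp add: jump_def)
      ultimately have "int K * V (Suc t) (\<tau> t j) = int K * (V t j + (if j = w t then int m else 0))"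
        using that V[of t j] V[of "Suc t" "\<tau> t j"] \<open>t < n\<close>
        by (simp only: distrib_left)
      then show ?thesis using K(1) by simp
    qed
    then show ?thesis using J mono that by (simp add: jump_def)
  qed
  moreover have "V n j = V 0 j + int n" if "j < m" for j
  proof -
    have "int K * V n j = int K * (V 0 j + int n)"
      using Zn V[of n j] V[of 0 j] that by (simp add: algebra_simps)
    then show ?thesis using K(1) by simp
  qed
  moreover have "V 0 0 = 0" by (simp add: V_def)
  \<comment> \<open>The entry reached after \<open>l\<close> applications of \<open>\<sigma>\<close>
    is congruent to \<open>- n l\<close> modulo \<open>m\<close>, so congruent entries have the same
    \<open>l\<close>.\<close>
  moreover have "i = j" if ij: "i < m" "j < m" and dvd: "int m dvd V 0 i - V 0 j" for i j
  proof -
    obtain l l' where l: "l < m" "i = (\<sigma> ^^ l) 0" "l' < m" "j = (\<sigma> ^^ l') 0" using orb ij by metis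
    obtain b b' where "Z 0 i = Z 0 0 + int K * (int m * b - int n * int l)"
      "Z 0 j = Z 0 0 + int K * (int m * b' - int n * int l')"
      using val l by meson
    then have "V 0 i = int m * b - int n * int l" "V 0 j = int m * b' - int n * int l'"
      using V[of 0 i] V[of 0 j] ij K(1) by auto
    then have "int n * (int l - int l') = int m * (b - b') - (V 0 i - V 0 j)"
      by (simp add: algebra_simps)
    then have "int m dvd int n * (int l - int l')" using dvd by simp
    then have "l = l'" using l \<open>coprime m n\<close> by (intro eq_if_dvd_mult_diff)
    then show ?thesis using l by simp
  qed
  ultimately show ?thesis using that by blast
qed

section \<open>Filters and complete residue systems\<close>

text \<open>When \<open>A\<close> is the set of row minima of a filter, this is the set of levels of
  its points; see \<open>filter_levels_eq\<close>.\<close>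

definition progressions :: "nat \<Rightarrow> int set \<Rightarrow> int set" where
  "progressions m A = {x. \<exists>a\<in>A. a \<le> x \<and> int m dvd x - a}"

definition complete_residues :: "nat \<Rightarrow> int set \<Rightarrow> bool" where
  "complete_residues m A \<longleftrightarrow> (\<forall>r. \<exists>!a. a \<in> A \<and> int m dvd a - r)"

lemma subset_progressions: "A \<subseteq> progressions m A"
  by (auto simp: progressions_def)

lemma progressions_subset: "A \<subseteq> progressions m B \<Longrightarrow> progressions m A \<subseteq> progressions m B"
proof
  fix x assume A: "A \<subseteq> progressions m B" and "x \<in> progressions m A"
  then obtain a where a: "a \<in> A" "a \<le> x" "int m dvd x - a" by (auto simp: progressions_def)
  then obtain b where b: "b \<in> B" "b \<le> a" "int m dvd a - b" using A by (auto simp: progressions_def)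
  have "int m dvd (x - a) + (a - b)" using a b by (intro dvd_add)
  then show "x \<in> progressions m B" using a b by (auto simp: progressions_def intro!: bexI[of _ b])
qed

lemma complete_residues_card:
  assumes "0 < m" "complete_residues m A"
  shows "finite A \<and> card A = m"
proof -
  have "inj_on (\<lambda>a. a mod int m) A"
  proof (rule inj_onI)
    fix a b assume "a \<in> A" "b \<in> A" "a mod int m = b mod int m"
    then have "int m dvd a - b" by (simp add: mod_eq_dvd_iff)
    moreover have "int m dvd b - b" by simp
    ultimately show "a = b"
      using assms(2) \<open>a \<in> A\<close> \<open>b \<in> A\<close> unfolding complete_residues_def by blast
  qed
  moreover have "(\<lambda>a. a mod int m) ` A = {0..<int m}"
  proof (intro equalityI subsetI)
    fix r assume r: "r \<in> {0..<int m}"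
    then obtain a where "a \<in> A" "int m dvd a - r" using assms(2) unfolding complete_residues_def by meson
    then have "a mod int m = r mod int m" by (simp add: mod_eq_dvd_iff)
    then show "r \<in> (\<lambda>a. a mod int m) ` A" using r \<open>a \<in> A\<close> by (auto intro!: image_eqI[of _ _ a])
  qed (use assms(1) in auto)
  ultimately have "bij_betw (\<lambda>a. a mod int m) A {0..<int m}" by (simp add: bij_betw_def)
  then show ?thesis using bij_betw_finite bij_betw_same_card by fastforce
qed

lemma complete_residues_replace:
  assumes "0 < m" "complete_residues m A" "p \<in> A"
  shows "complete_residues m ((A - {p}) \<union> {p + int m})"
  unfolding complete_residues_def
proof
  fix r
  obtain a where a: "a \<in> A" "int m dvd a - r" and u: "\<And>b. b \<in> A \<Longrightarrow> int m dvd b - r \<Longrightarrow> b = a"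
    using assms(2) unfolding complete_residues_def by meson
  have eq: "int m dvd (p + int m) - r \<longleftrightarrow> int m dvd p - r"
    using dvd_add_left_iff[of "int m" "int m" "p - r"] by (simp add: algebra_simps)
  show "\<exists>!a. a \<in> (A - {p}) \<union> {p + int m} \<and> int m dvd a - r"
  proof (cases "a = p")
    case True
    then show ?thesis using a(2) eq u by (intro ex1I[of _ "p + int m"]) blast+
  next
    case False
    then have "\<not> int m dvd (p + int m) - r" using eq u assms(3) by blast
    then show ?thesis using False a u by (intro ex1I[of _ a]) blast+
  qed
qed

lemma complete_residuesI:
  assumes "0 < m" "finite A" "card A = m" "\<And>a b. a \<in> A \<Longrightarrow> b \<in> A \<Longrightarrow> int m dvd a - b \<Longrightarrow> a = b"
  shows "complete_residues m A"
  unfolding complete_residues_def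
proof
  fix r
  have inj: "inj_on (\<lambda>a. a mod int m) A"
    by (rule inj_onI) (use assms(4) mod_eq_dvd_iff in blast)
  have "(\<lambda>a. a mod int m) ` A = {0..<int m}"
    using assms inj by (intro card_subset_eq) (auto simp: card_image)
  moreover have "r mod int m \<in> {0..<int m}" using assms(1) by simp
  ultimately have "r mod int m \<in> (\<lambda>a. a mod int m) ` A" by simp
  then obtain a where a: "a \<in> A" "a mod int m = r mod int m" by (auto simp: image_iff)
  show "\<exists>!a. a \<in> A \<and> int m dvd a - r"
  proof (rule ex1I[of _ a])
    show "a \<in> A \<and> int m dvd a - r" using a by (simp add: mod_eq_dvd_iff)
    fix b assume "b \<in> A \<and> int m dvd b - r"
    then have "b \<in> A" "b mod int m = r mod int m" by (auto simp: mod_eq_dvd_iff)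
    then show "b = a" using a inj_onD[OF inj, of b a] by simp
  qed
qed

section \<open>Levels of filters\<close>

lemma obtain_level:
  assumes "coprime m n"
  obtains i j where "level m n (i, j) = x"
proof -
  obtain u v where "u * int m + v * int n = gcd (int m) (int n)" using bezout_int by blast
  then have "x * (u * int m + v * int n) = x" using assms by simp
  then have "level m n (x * u, x * v) = x" by (simp add: level_def algebra_simps)
  then show ?thesis by (rule that)
qed

text \<open>A Bezout coefficient is reduced modulo \<open>m\<close> to make the multiplier a natural
  number, since the levels of a filter are closed under adding \<open>n\<close> but not under
  subtracting it.\<close>

lemma obtain_multiple_mod:
  assumes "0 < m" "coprime m n"
  obtains j where "int m dvd x - int n * int j"
proof -
  obtain u v where uv: "u * int m + v * int n = gcd (int m) (int n)" using bezout_int by blast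
  define j where "j = nat ((x * v) mod int m)"
  have "int j = (x * v) mod int m" using assms(1) by (simp add: j_def)
  then have "int j mod int m = (x * v) mod int m" by simp
  then have "int m dvd x * v - int j" by (metis mod_eq_dvd_iff)
  then have "int m dvd int n * (x * v - int j) + int m * (x * u)" by simp
  also have "int n * (x * v - int j) + int m * (x * u) = x * (u * int m + v * int n) - int n * int j"
    by (simp add: algebra_simps)
  finally show ?thesis using that uv assms(2) by simp
qed

context
  fixes m n :: nat and F :: "(int \<times> int) set"
  assumes m: "0 < m" and cop: "coprime m n" and F: "mn_filter m n F"
begin

lemma filter_saturated: "p \<in> F \<longleftrightarrow> level m n p \<in> level m n ` F"
  using F unfolding mn_filter_def by (auto simp del: split_paired_All)

lemma filter_levels_add_m:
  assumes "x \<in> level m n ` F"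
  shows "x + int m * int k \<in> level m n ` F"
proof -
  obtain i j where ij: "(i, j) \<in> F" "x = level m n (i, j)" using assms by auto
  then have "(i + int k, j) \<in> F" using F unfolding mn_filter_def
    by (meson le_add_same_cancel1 of_nat_0_le_iff order_refl)
  moreover have "level m n (i + int k, j) = x + int m * int k"
    by (simp add: ij level_def algebra_simps)
  ultimately show ?thesis by (metis imageI)
qed

lemma filter_levels_add_n:
  assumes "x \<in> level m n ` F"
  shows "x + int n * int k \<in> level m n ` F"
proof -
  obtain i j where ij: "(i, j) \<in> F" "x = level m n (i, j)" using assms by auto
  then have "(i, j + int k) \<in> F" using F unfolding mn_filter_def
    by (meson le_add_same_cancel1 of_nat_0_le_iff order_refl)
  moreover have "level m n (i, j + int k) = x + int n * int k"
    by (simp add: ij level_def algebra_simps)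
  ultimately show ?thesis by (metis imageI)
qed

text \<open>One step to the left in a row lowers the level by \<open>m\<close>, and membership
  depends on the level alone, so the rows disappear from the description.\<close>

lemma row_minima_levels:
  "row_minima m n F = {x \<in> level m n ` F. x - int m \<notin> level m n ` F}"
proof (intro equalityI subsetI)
  fix x assume "x \<in> row_minima m n F"
  then obtain i j where ij: "(i, j) \<in> F" "level m n (i, j) = x"
    and min: "\<And>i. (i, j) \<in> F \<Longrightarrow> x \<le> level m n (i, j)"
    by (auto simp: row_minima_def)
  have "level m n (i - 1, j) = x - int m" using ij(2) by (simp add: level_def algebra_simps)
  then have "x - int m \<notin> level m n ` F"
    using filter_saturated[of "(i - 1, j)"] min[of "i - 1"] m by auto
  then show "x \<in> {x \<in> level m n ` F. x - int m \<notin> level m n ` F}" using ij by force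
next
  fix x assume "x \<in> {x \<in> level m n ` F. x - int m \<notin> level m n ` F}"
  then obtain i j where ij: "(i, j) \<in> F" "x = level m n (i, j)" and not: "x - int m \<notin> level m n ` F"
    by auto
  have "x \<le> level m n (i', j)" if "(i', j) \<in> F" for i'
  proof (rule ccontr)
    assume less: "\<not> x \<le> level m n (i', j)"
    then have "i' * int m < i * int m" using ij(2) by (simp add: level_def)
    then have "i' < i" using m by simp
    then have "level m n (i', j) + int m * int (nat (i - 1 - i')) = x - int m"
      by (simp add: ij level_def algebra_simps)
    then show False using filter_levels_add_m[of "level m n (i', j)"] that not by (metis imageI)
  qed
  then show "x \<in> row_minima m n F" using ij by (auto simp: row_minima_def)
qed

lemma filter_levels_residue:
  obtains x where "x \<in> level m n ` F" "int m dvd x - r"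
proof -
  obtain y where y: "y \<in> level m n ` F" using F by (auto simp: mn_filter_def)
  obtain j where "int m dvd (r - y) - int n * int j" using obtain_multiple_mod[OF m cop] by blast
  then have "int m dvd (y + int n * int j) - r" by (simp add: dvd_diff_commute algebra_simps)
  then show ?thesis using that filter_levels_add_n[OF y] by blast
qed

text \<open>If one progression of difference \<open>m\<close> went down forever, adding multiples of
  \<open>n\<close> would carry it to all residues and every integer would be a level.\<close>

lemma filter_levels_bounded_below: "\<exists>k. x - int m * int k \<notin> level m n ` F"
proof (rule ccontr)
  assume "\<nexists>k. x - int m * int k \<notin> level m n ` F"
  then have all: "x - int m * int k \<in> level m n ` F" for k by blast
  have "y \<in> level m n ` F" for y
  proof -
    obtain j where "int m dvd (y - x) - int n * int j" using obtain_multiple_mod[OF m cop] by blast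
    then obtain d where d: "y - x - int n * int j = int m * d" by (auto simp: dvd_def)
    \<comment> \<open>A negative \<open>d\<close> is absorbed by starting lower, a positive one by
      adding multiples of \<open>m\<close>.\<close>
    have "x - int m * int (nat (- d)) + int n * int j + int m * int (nat d) \<in> level m n ` F"
      by (intro filter_levels_add_m filter_levels_add_n all)
    also have "x - int m * int (nat (- d)) + int n * int j + int m * int (nat d) = y"
      using d by (cases "0 \<le> d") (auto simp: algebra_simps)
    finally show ?thesis .
  qed
  then have "F = UNIV" using filter_saturated by blast
  then show False using F by (simp add: mn_filter_def)
qed

text \<open>Descending from a level in steps of \<open>m\<close>, the last level before the first
  failure is a row minimum.\<close>

lemma filter_levels_eq: "level m n ` F = progressions m (row_minima m n F)"
proof (intro equalityI subsetI)
  fix x assume x: "x \<in> level m n ` F"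
  define k where "k = (LEAST k. x - int m * int k \<notin> level m n ` F)"
  have k: "x - int m * int k \<notin> level m n ` F"
    unfolding k_def by (rule LeastI_ex) (rule filter_levels_bounded_below)
  then obtain l where l: "k = Suc l" using x by (cases k) auto
  have "x - int m * int l \<in> level m n ` F"
    using not_less_Least[of l "\<lambda>k. x - int m * int k \<notin> level m n ` F"] l
    unfolding k_def by (metis lessI)
  then have "x - int m * int l \<in> row_minima m n F"
    using k by (simp add: row_minima_levels l algebra_simps)
  then show "x \<in> progressions m (row_minima m n F)"
    unfolding progressions_def by (auto intro!: bexI[of _ "x - int m * int l"])
next
  fix x assume "x \<in> progressions m (row_minima m n F)"
  then obtain a d where a: "a \<in> row_minima m n F" "a \<le> x" "x - a = int m * d"
    by (auto simp: progressions_def dvd_def)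
  then have "0 \<le> int m * d" by linarith
  then have "0 \<le> d" using m by (simp add: zero_le_mult_iff)
  then have "x = a + int m * int (nat d)" using a by simp
  moreover have "a \<in> level m n ` F" using a(1) by (simp add: row_minima_levels)
  ultimately show "x \<in> level m n ` F" using filter_levels_add_m by blast
qed

lemma filter_eq_progressions: "F = {p. level m n p \<in> progressions m (row_minima m n F)}"
  using filter_saturated filter_levels_eq by auto

text \<open>Every residue occurs among the levels. Two distinct congruent minima are impossible, as
  the larger one lowered by \<open>m\<close> would still be a level.\<close>

lemma row_minima_complete: "complete_residues m (row_minima m n F)"
  unfolding complete_residues_def
proof
  fix r
  obtain x where x: "x \<in> level m n ` F" "int m dvd x - r" using filter_levels_residue by blast
  then obtain a where a: "a \<in> row_minima m n F" "int m dvd x - a"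
    using filter_levels_eq by (auto simp: progressions_def)
  have "int m dvd (x - r) - (x - a)" by (rule dvd_diff[OF x(2) a(2)])
  then have ar: "int m dvd a - r" by simp
  have less: False
    if bc: "b \<in> row_minima m n F" "c \<in> row_minima m n F" "int m dvd c - b" "b < c" for b c
  proof -
    obtain d where d: "c - b = int m * d" using bc(3) by (auto simp: dvd_def)
    then have "0 < int m * d" using bc(4) by linarith
    then have "0 < d" using m by (simp add: zero_less_mult_iff)
    then have "c - int m = b + int m * int (nat (d - 1))" using d by (simp add: algebra_simps)
    moreover have "b \<in> level m n ` F" "c - int m \<notin> level m n ` F"
      using bc(1,2) by (simp_all add: row_minima_levels)
    ultimately show False using filter_levels_add_m by metis
  qed
  show "\<exists>!a. a \<in> row_minima m n F \<and> int m dvd a - r"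
  proof (rule ex1I[of _ a])
    fix b assume b: "b \<in> row_minima m n F \<and> int m dvd b - r"
    then have "int m dvd (b - r) - (a - r)" using dvd_diff[OF _ ar] by blast
    then have "int m dvd b - a" "int m dvd a - b" by (auto simp: dvd_diff_commute)
    then show "b = a" using less[of a b] less[of b a] a(1) b by (cases a b rule: linorder_cases) auto
  qed (use a ar in auto)
qed

lemma dyck_iff_row_minima:
  "dyck m n F \<longleftrightarrow> 0 \<in> row_minima m n F \<and> (\<forall>a\<in>row_minima m n F. 0 \<le> a)"
proof
  assume "dyck m n F"
  then show "0 \<in> row_minima m n F \<and> (\<forall>a\<in>row_minima m n F. 0 \<le> a)"
    using m by (force simp: dyck_def row_minima_levels)
next
  assume A: "0 \<in> row_minima m n F \<and> (\<forall>a\<in>row_minima m n F. 0 \<le> a)"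
  then have "\<forall>x\<in>level m n ` F. 0 \<le> x" unfolding filter_levels_eq by (force simp: progressions_def)
  moreover have "0 \<in> level m n ` F" using A by (simp add: row_minima_levels)
  ultimately show "dyck m n F" by (force simp: dyck_def)
qed

end

text \<open>Closure under adding \<open>m\<close> is built into \<open>progressions\<close>; with
  closure under adding \<open>n\<close> it gives upward closure, as these are the level changes of
  unit steps.\<close>

lemma filter_of_residues:
  assumes m: "0 < m" and cop: "coprime m n" and A: "complete_residues m A"
    and closed: "\<And>a. a \<in> A \<Longrightarrow> a + int n \<in> progressions m A"
  defines "F \<equiv> {p. level m n p \<in> progressions m A}"
  shows "mn_filter m n F" "row_minima m n F = A"
proof -
  have lev: "level m n ` F = progressions m A"
  proof (intro equalityI subsetI)
    fix x assume x: "x \<in> progressions m A"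
    obtain i j where "level m n (i, j) = x" using obtain_level[OF cop] by blast
    then show "x \<in> level m n ` F" using x by (auto simp: F_def)
  qed (auto simp: F_def)
  have addm: "x + int m * int k \<in> progressions m A" if x: "x \<in> progressions m A" for x k
  proof -
    obtain a where a: "a \<in> A" "a \<le> x" "int m dvd x - a" using x unfolding progressions_def by blast
    have "int m dvd (x - a) + int m * int k" using a(3) by simp
    then show ?thesis using a by (auto simp: progressions_def algebra_simps intro!: bexI[of _ a])
  qed
  have addn1: "x + int n \<in> progressions m A" if x: "x \<in> progressions m A" for x
  proof -
    obtain a where a: "a \<in> A" "a \<le> x" "int m dvd x - a" using x unfolding progressions_def by blast
    have "x + int n \<in> progressions m (progressions m A)"
      unfolding progressions_def[of m "progressions m A"] using closed[OF a(1)] a by (auto intro!: bexI[of _ "a + int n"])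
    then show ?thesis using progressions_subset[of "progressions m A" m A] by auto
  qed
  have addn: "x + int n * int k \<in> progressions m A" if x: "x \<in> progressions m A" for x k
  proof (induction k)
    case (Suc k)
    then show ?case using addn1[of "x + int n * int k"] by (simp add: algebra_simps)
  qed (use that in simp)
  have fin: "finite A" "card A = m" using complete_residues_card[OF m A] by auto
  have "A \<noteq> {}" using fin m by auto
  have ne: "F \<noteq> {}" using lev \<open>A \<noteq> {}\<close> subset_progressions[of A m] by auto
  have "Min A - 1 \<notin> progressions m A"
  proof
    assume "Min A - 1 \<in> progressions m A"
    then obtain a where "a \<in> A" "a \<le> Min A - 1" unfolding progressions_def by blast
    then show False using Min_le[OF fin(1), of a] by linarith
  qed
  then have "F \<noteq> UNIV" using lev obtain_level[OF cop, of "Min A - 1"] by (metis UNIV_I imageI)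
  moreover have "(i', j') \<in> F" if "(i, j) \<in> F" "i \<le> i'" "j \<le> j'" for i j i' j'
  proof -
    have "level m n (i, j) + int m * int (nat (i' - i)) + int n * int (nat (j' - j)) \<in> progressions m A"
      by (intro addn addm) (use that in \<open>simp add: F_def\<close>)
    also have "level m n (i, j) + int m * int (nat (i' - i)) + int n * int (nat (j' - j)) =
      level m n (i', j')"
      using that by (simp add: level_def algebra_simps)
    finally show ?thesis by (simp add: F_def)
  qed
  ultimately show filt: "mn_filter m n F"
    unfolding mn_filter_def using ne by (auto simp: F_def)
  have "x \<in> A \<longleftrightarrow> x \<in> progressions m A \<and> x - int m \<notin> progressions m A" for x
  proof
    assume x: "x \<in> A"
    have "x - int m \<notin> progressions m A"
    proof
      assume "x - int m \<in> progressions m A"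
      then obtain a where a: "a \<in> A" "a \<le> x - int m" "int m dvd (x - int m) - a"
        unfolding progressions_def by blast
      have "int m dvd ((x - int m) - a) + int m" by (rule dvd_add[OF a(3) dvd_refl])
      then have "int m dvd a - x" by (simp add: dvd_diff_commute)
      moreover have "int m dvd x - x" by simp
      ultimately have "a = x" using A x a(1) unfolding complete_residues_def by blast
      then show False using a(2) m by simp
    qed
    then show "x \<in> progressions m A \<and> x - int m \<notin> progressions m A" using x subset_progressions by blast
  next
    assume x: "x \<in> progressions m A \<and> x - int m \<notin> progressions m A"
    then obtain a d where a: "a \<in> A" "a \<le> x" "x - a = int m * d"
      unfolding progressions_def dvd_def by blast
    have "d \<le> 0"
    proof (rule ccontr)
      assume "\<not> d \<le> 0"
      then have "a + int m * int (nat (d - 1)) = x - int m" using a by (simp add: algebra_simps)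
      then show False using addm[of a] a(1) subset_progressions[of A m] x by (metis subsetD)
    qed
    moreover have "0 \<le> int m * d" using a by linarith
    ultimately have "d = 0" using m by (simp add: zero_le_mult_iff)
    then show "x \<in> A" using a by simp
  qed
  then show "row_minima m n F = A" using row_minima_levels[OF m cop filt] lev by auto
qed

section \<open>The bijection\<close>

text \<open>This links \<open>B_map\<close> to jumps: a letter counts the minima below the chosen
  one, which is its index in the increasing enumeration.\<close>

lemma strict_mono_on_rank:
  fixes X :: "nat \<Rightarrow> 'a :: linorder"
  assumes "strict_mono_on {..<m} X" "k < m"
  shows "card {x \<in> X ` {..<m}. x < X k} = k"
proof -
  have "X j < X k \<longleftrightarrow> j < k" if "j < m" for j
    using strict_mono_on_less[OF assms(1)] assms(2) that by auto
  then have "{x \<in> X ` {..<m}. x < X k} = X ` {..<k}" using assms(2) by force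
  moreover have "inj_on X {..<k}"
    using assms by (intro inj_on_subset[OF strict_mono_on_imp_inj_on[OF assms(1)]]) auto
  ultimately show ?thesis by (simp add: card_image)
qed

lemma strict_mono_on_image_eq:
  fixes X Y :: "nat \<Rightarrow> 'a :: linorder"
  assumes "strict_mono_on {..<m} X" "strict_mono_on {..<m} Y" "X ` {..<m} = Y ` {..<m}" "j < m"
  shows "X j = Y j"
proof -
  have "X j \<in> Y ` {..<m}" using assms(3,4) by blast
  then obtain i where i: "i < m" "X j = Y i" by auto
  then have "i = j"
    using strict_mono_on_rank[OF assms(1,4)] strict_mono_on_rank[OF assms(2) i(1)] assms(3) by simp
  then show ?thesis using i by simp
qed

lemma ex_strict_mono_enumeration:
  fixes A :: "'a :: linorder set"
  assumes "finite A"
  shows "\<exists>X. strict_mono_on {..<card A} X \<and> X ` {..<card A} = A"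
proof -
  let ?l = "sorted_list_of_set A"
  have "strict_mono_on {..<card A} ((!) ?l)"
    using sorted_wrt_nth_less[OF strict_sorted_list_of_set[of A]] by (auto intro!: strict_mono_onI)
  moreover have "(!) ?l ` {..<card A} = A"
  proof -
    have "(!) ?l ` {..<length ?l} = set ?l" by (auto simp: set_conv_nth)
    then show ?thesis using assms by simp
  qed
  ultimately show ?thesis by blast
qed

lemma image_increment:
  fixes X :: "nat \<Rightarrow> int"
  assumes "inj_on X {..<m}" "k < m"
  shows "(\<lambda>j. X j + (if j = k then c else 0)) ` {..<m} = (X ` {..<m} - {X k}) \<union> {X k + c}"
proof -
  let ?g = "\<lambda>j. X j + (if j = k then c else 0)"
  have "?g ` {..<m} = ?g ` ({..<m} - {k}) \<union> {?g k}" using assms(2) by blast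
  also have "?g ` ({..<m} - {k}) = X ` ({..<m} - {k})" by (intro image_cong) auto
  also have "\<dots> = X ` {..<m} - {X k}"
    using assms by (subst inj_on_image_set_diff[OF assms(1)]) auto
  finally show ?thesis by simp
qed

lemma jump_image:
  assumes "jump m c k \<tau> X Y" "k < m"
  shows "Y ` {..<m} = (X ` {..<m} - {X k}) \<union> {X k + c}"
proof -
  have "Y ` {..<m} = Y ` \<tau> ` {..<m}" using assms(1) by (simp add: jump_def permutes_image)
  also have "\<dots> = (\<lambda>j. X j + (if j = k then c else 0)) ` {..<m}"
    using assms(1) unfolding image_image by (intro image_cong) (auto simp: jump_def)
  finally show ?thesis
    using assms image_increment[of X m k c] by (simp add: jump_def strict_mono_on_imp_inj_on)
qed

lemma jump_of_image:
  assumes X: "strict_mono_on {..<m} X" and Y: "strict_mono_on {..<m} Y" and "k < m"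
    and img: "Y ` {..<m} = (X ` {..<m} - {X k}) \<union> {X k + c}"
  obtains \<tau> where "jump m c k \<tau> X Y"
proof -
  define g where "g j = X j + (if j = k then c else 0)" for j
  have gY: "g ` {..<m} = Y ` {..<m}"
    unfolding g_def img using image_increment[OF strict_mono_on_imp_inj_on[OF X] \<open>k < m\<close>] .
  have Yinj: "inj_on Y {..<m}" using Y by (rule strict_mono_on_imp_inj_on)
  \<comment> \<open>\<open>g\<close> takes as many values as \<open>Y\<close>, so the raised entry
    does not collide with another one.\<close>
  have "inj_on g {..<m}" by (rule eq_card_imp_inj_on) (simp_all add: gY card_image[OF Yinj])
  then have g: "bij_betw g {..<m} (Y ` {..<m})" using gY by (simp add: bij_betw_def)
  have Yb: "bij_betw Y {..<m} (Y ` {..<m})" using Yinj by (simp add: bij_betw_def)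
  define \<tau> where "\<tau> j = (if j < m then inv_into {..<m} Y (g j) else j)" for j
  have "bij_betw (inv_into {..<m} Y \<circ> g) {..<m} {..<m}"
    using bij_betw_trans[OF g bij_betw_inv_into[OF Yb]] .
  then have "bij_betw \<tau> {..<m} {..<m}"
    by (rule bij_betw_cong[THEN iffD1, rotated]) (simp add: \<tau>_def)
  then have "\<tau> permutes {..<m}" by (rule bij_imp_permutes) (simp add: \<tau>_def)
  moreover have "Y (\<tau> j) = g j" if "j < m" for j
    using that gY by (simp add: \<tau>_def f_inv_into_f flip: gY)
  ultimately have "jump m c k \<tau> X Y" using X Y by (simp add: jump_def g_def)
  then show ?thesis by (rule that)
qed

lemma filter_tuple_nth:
  assumes "filter_tuple m n (fs, ps)" "t \<le> n"
  shows "mn_filter m n (fs ! t)"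
proof -
  have "fs ! t \<in> set fs" using assms by (intro nth_mem) (simp add: filter_tuple_def)
  then show ?thesis using assms(1) by (simp add: filter_tuple_def)
qed

text \<open>Enumerating the row minima turns a tuple into jumps along its word; the closing
  condition becomes translation by \<open>n\<close>, and the Dyck condition puts the lowest initial
  entry at 0.\<close>

lemma parking_tuple_jumps:
  assumes m: "0 < m" and cop: "coprime m n" and P: "(fs, ps) \<in> parking_tuples m n"
  obtains X \<tau> where
    "\<forall>t<n. jump m (int m) (B_map m n (fs, ps) ! t) (\<tau> t) (X t) (X (Suc t))"
    "\<forall>j<m. X n j = X 0 j + int n" "X 0 0 = 0"
    "\<forall>t\<le>n. strict_mono_on {..<m} (X t) \<and> X t ` {..<m} = row_minima m n (fs ! t)"
    "\<forall>t<n. B_map m n (fs, ps) ! t < m \<and> X t (B_map m n (fs, ps) ! t) = ps ! t"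
proof -
  define R where "R t = row_minima m n (fs ! t)" for t
  define w where "w = B_map m n (fs, ps)"
  have tup: "filter_tuple m n (fs, ps)" and dyck: "dyck m n (fs ! 0)"
    using P by (simp_all add: parking_tuples_def)
  note filt = filter_tuple_nth[OF tup]
  have step: "ps ! t \<in> R t \<and> R (Suc t) = (R t - {ps ! t}) \<union> {ps ! t + int m}" if "t < n" for t
    using tup that by (simp add: filter_tuple_def R_def)
  have Rn: "R n = {x + int n | x. x \<in> R 0}"
    using tup by (simp add: filter_tuple_def R_def)
  have w: "w ! t = card {x \<in> R t. x < ps ! t}" if "t < n" for t
    using that by (simp add: w_def B_map_def R_def)
  have fin: "finite (R t) \<and> card (R t) = m" if "t \<le> n" for t
    unfolding R_def using complete_residues_card[OF m row_minima_complete[OF m cop filt[OF that]]] .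
  have "\<exists>X. strict_mono_on {..<m} X \<and> X ` {..<m} = R t" if "t \<le> n" for t
    using ex_strict_mono_enumeration[of "R t"] fin[OF that] by simp
  then obtain X where X: "\<forall>t\<le>n. strict_mono_on {..<m} (X t) \<and> X t ` {..<m} = R t" by metis
  have rank: "w ! t < m \<and> X t (w ! t) = ps ! t" if "t < n" for t
  proof -
    have "ps ! t \<in> X t ` {..<m}" using X step that by simp
    then obtain k where k: "k < m" "ps ! t = X t k" by auto
    then have "w ! t = k" using strict_mono_on_rank[of m "X t" k] X that w by simp
    then show ?thesis using k by simp
  qed
  have "\<exists>\<tau>. jump m (int m) (w ! t) \<tau> (X t) (X (Suc t))" if "t < n" for t
  proof -
    have "X (Suc t) ` {..<m} = (X t ` {..<m} - {X t (w ! t)}) \<union> {X t (w ! t) + int m}"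
      using X that step[OF that] rank[OF that] by simp
    then show ?thesis using jump_of_image[of m "X t" "X (Suc t)" "w ! t" "int m"] X that rank[OF that]
      by (metis Suc_leI less_imp_le)
  qed
  then obtain \<tau> where J: "\<forall>t<n. jump m (int m) (w ! t) (\<tau> t) (X t) (X (Suc t))" by metis
  have "\<forall>j<m. X n j = X 0 j + int n"
  proof (intro allI impI)
    fix j assume "j < m"
    moreover have "strict_mono_on {..<m} (\<lambda>j. X 0 j + int n)"
      using X by (auto simp: strict_mono_on_def)
    moreover have "X n ` {..<m} = (\<lambda>j. X 0 j + int n) ` {..<m}"
    proof -
      have "X n ` {..<m} = (\<lambda>x. x + int n) ` X 0 ` {..<m}" using X Rn by (auto simp: image_def)
      then show ?thesis by (simp add: image_image)
    qed
    ultimately show "X n j = X 0 j + int n"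
      using X strict_mono_on_image_eq[of m "X n" "\<lambda>j. X 0 j + int n" j] by simp
  qed
  moreover have "X 0 0 = 0"
  proof -
    have R0: "0 \<in> R 0" "\<And>a. a \<in> R 0 \<Longrightarrow> 0 \<le> a"
      using dyck dyck_iff_row_minima[OF m cop filt[of 0]] by (auto simp: R_def)
    then have "0 \<in> X 0 ` {..<m}" using X by simp
    then obtain j where j: "j < m" "X 0 j = 0" by auto
    then have "X 0 0 \<le> 0" using X strict_mono_on_leD[of "{..<m}" "X 0" 0 j] by simp
    moreover have "X 0 0 \<in> R 0" using X m by blast
    ultimately show ?thesis using R0(2) by force
  qed
  ultimately show ?thesis using that[of \<tau> X] J X rank by (simp add: w_def R_def)
qed

section \<open>Injectivity, parking condition and surjectivity\<close>

lemma B_map_inj_on: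
  assumes m: "0 < m" and cop: "coprime m n"
  shows "inj_on (B_map m n) (parking_tuples m n)"
proof (rule inj_onI, clarify)
  fix fs ps fs' ps'
  assume P: "(fs, ps) \<in> parking_tuples m n" and P': "(fs', ps') \<in> parking_tuples m n"
    and eq: "B_map m n (fs, ps) = B_map m n (fs', ps')"
  define w where "w = B_map m n (fs, ps)"
  obtain X \<tau> where J: "\<forall>t<n. jump m (int m) (w ! t) (\<tau> t) (X t) (X (Suc t))"
    "\<forall>j<m. X n j = X 0 j + int n" "X 0 0 = 0"
    and X: "\<forall>t\<le>n. strict_mono_on {..<m} (X t) \<and> X t ` {..<m} = row_minima m n (fs ! t)"
    and w: "\<forall>t<n. w ! t < m \<and> X t (w ! t) = ps ! t"
    by (rule parking_tuple_jumps[OF m cop P, folded w_def])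
  obtain X' \<tau>' where J': "\<forall>t<n. jump m (int m) (w ! t) (\<tau>' t) (X' t) (X' (Suc t))"
    "\<forall>j<m. X' n j = X' 0 j + int n" "X' 0 0 = 0"
    and X': "\<forall>t\<le>n. strict_mono_on {..<m} (X' t) \<and> X' t ` {..<m} = row_minima m n (fs' ! t)"
    and w': "\<forall>t<n. w ! t < m \<and> X' t (w ! t) = ps' ! t"
    by (rule parking_tuple_jumps[OF m cop P', folded eq, folded w_def])
  have wm: "w ! t < m" if "t < n" for t using w that by simp
  \<comment> \<open>Uniqueness gives equal initial states; each later state is determined by its
    predecessor and the letter.\<close>
  have same: "X t j = X' t j" if "t \<le> n" "j < m" for t j
    using that
  proof (induction t arbitrary: j)
    case 0
    show ?case using jumps_cycle_unique[OF J(1) J'(1) J(2) J'(2) cop m] J(3) J'(3) 0 by simp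
  next
    case (Suc t)
    have "X (Suc t) ` {..<m} = (X t ` {..<m} - {X t (w ! t)}) \<union> {X t (w ! t) + int m}"
      using J(1) w Suc.prems by (intro jump_image[of m _ _ "\<tau> t"]) auto
    also have "X t ` {..<m} = X' t ` {..<m}" using Suc by (intro image_cong) auto
    also have "X t (w ! t) = X' t (w ! t)" using Suc.IH[of "w ! t"] Suc.prems wm by simp
    also have "(X' t ` {..<m} - {X' t (w ! t)}) \<union> {X' t (w ! t) + int m} = X' (Suc t) ` {..<m}"
      using J'(1) w Suc.prems by (intro jump_image[of m _ _ "\<tau>' t", symmetric]) auto
    finally have img: "X (Suc t) ` {..<m} = X' (Suc t) ` {..<m}" .
    show ?case by (rule strict_mono_on_image_eq[OF _ _ img]) (use X X' Suc.prems in auto)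
  qed
  have len: "length fs = n + 1" "length fs' = n + 1" "length ps = n" "length ps' = n"
    and tup: "filter_tuple m n (fs, ps)" "filter_tuple m n (fs', ps')"
    using P P' by (simp_all add: parking_tuples_def filter_tuple_def)
  have "fs ! t = fs' ! t" if "t \<le> n" for t
  proof -
    have "row_minima m n (fs ! t) = row_minima m n (fs' ! t)"
    proof -
      have "X t ` {..<m} = X' t ` {..<m}" using same that by (intro image_cong) auto
      then show ?thesis using X X' that by simp
    qed
    then show ?thesis
      using filter_eq_progressions[OF m cop filter_tuple_nth[OF tup(1) that]]
        filter_eq_progressions[OF m cop filter_tuple_nth[OF tup(2) that]] by (simp only:)
  qed
  moreover have "ps ! t = ps' ! t" if "t < n" for t
    using w w' same[of t "w ! t"] that by simp
  ultimately show "fs = fs' \<and> ps = ps'"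
    using len by (auto intro!: nth_equalityI)
qed

lemma B_map_parking_word:
  assumes m: "0 < m" and cop: "coprime m n" and P: "(fs, ps) \<in> parking_tuples m n"
  shows "B_map m n (fs, ps) \<in> parking_words m n"
proof -
  define w where "w = B_map m n (fs, ps)"
  obtain X \<tau> where J: "\<forall>t<n. jump m (int m) (w ! t) (\<tau> t) (X t) (X (Suc t))"
    "\<forall>j<m. X n j = X 0 j + int n" "X 0 0 = 0"
    "\<forall>t\<le>n. strict_mono_on {..<m} (X t) \<and> X t ` {..<m} = row_minima m n (fs ! t)"
    and w: "\<forall>t<n. w ! t < m \<and> X t (w ! t) = ps ! t"
    by (rule parking_tuple_jumps[OF m cop P, folded w_def])
  have len: "length w = n" by (simp add: w_def B_map_def)
  have "real i * real n / real m \<le> real (card {j. j < n \<and> w ! j < i})" if "i \<le> m" for i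
  proof -
    have "sum (X n) {..<i} \<le> sum (X 0) {..<i} + int m * int (card {j. j < n \<and> w ! j < i})"
      by (rule jumps_sum_upper[OF J(1) that order_refl])
    moreover have "sum (X n) {..<i} = (\<Sum>j<i. X 0 j + int n)"
      using J(2) that by (intro sum.cong) auto
    ultimately have "int (i * n) \<le> int (m * card {j. j < n \<and> w ! j < i})"
      by (simp add: sum.distrib)
    then have "real (i * n) \<le> real (m * card {j. j < n \<and> w ! j < i})" by linarith
    then show ?thesis using m by (simp add: field_simps)
  qed
  moreover have "set w \<subseteq> {0..<m}" using w len by (auto simp: in_set_conv_nth)
  ultimately show ?thesis unfolding w_def[symmetric] using len by (simp add: parking_words_def)
qed

lemma B_map_surj:
  assumes m: "0 < m" and n: "0 < n" and cop: "coprime m n" and ws: "ws \<in> parking_words m n"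
  shows "ws \<in> B_map m n ` parking_tuples m n"
proof -
  have len: "length ws = n" and lt: "\<And>t. t < n \<Longrightarrow> ws ! t < m"
    and park: "\<And>i. 1 \<le> i \<Longrightarrow> i \<le> m \<Longrightarrow>
      real i * real n / real m \<le> real (card {t. t < n \<and> ws ! t < i})"
    using ws nth_mem by (fastforce simp: parking_words_def)+
  \<comment> \<open>The word is repeated periodically because the recurrence argument runs through
    arbitrarily many periods.\<close>
  define w where "w t = ws ! (t mod n)" for t
  have w: "\<forall>t. w t < m" "\<forall>t. w (t + n) = w t" using lt n by (auto simp: w_def)
  have wpark: "\<forall>i. 0 < i \<and> i < m \<longrightarrow> i * n \<le> m * card {t. t < n \<and> w t < i}"
  proof (intro allI impI)
    fix i assume "0 < i \<and> i < m"
    have "real (i * n) \<le> real (m * card {t. t < n \<and> ws ! t < i})"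
      using park[of i] \<open>0 < i \<and> i < m\<close> m by (simp add: field_simps)
    moreover have "{t. t < n \<and> w t < i} = {t. t < n \<and> ws ! t < i}" by (auto simp: w_def)
    ultimately show "i * n \<le> m * card {t. t < n \<and> w t < i}" by (simp only: of_nat_le_iff)
  qed
  obtain V \<tau> where J: "\<forall>t<n. jump m (int m) (w t) (\<tau> t) (V t) (V (Suc t))"
    and Vn: "\<forall>j<m. V n j = V 0 j + int n" and V0: "V 0 0 = 0"
    and dist: "\<forall>i<m. \<forall>j<m. int m dvd V 0 i - V 0 j \<longrightarrow> i = j"
    by (rule jumps_cycle_exists[OF m n cop w wpark])
  define A where "A t = V t ` {..<m}" for t
  have mono: "strict_mono_on {..<m} (V t)" if "t \<le> n" for t
    using J n that by (cases t) (auto simp: jump_def Suc_le_eq)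
  have step: "A (Suc t) = (A t - {V t (ws ! t)}) \<union> {V t (ws ! t) + int m}" "V t (ws ! t) \<in> A t"
    if "t < n" for t
  proof -
    have "jump m (int m) (ws ! t) (\<tau> t) (V t) (V (Suc t))" using J that by (auto simp: w_def)
    then show "A (Suc t) = (A t - {V t (ws ! t)}) \<union> {V t (ws ! t) + int m}"
      unfolding A_def using lt[OF that] by (rule jump_image)
    show "V t (ws ! t) \<in> A t" using lt[OF that] by (simp add: A_def)
  qed
  have An: "A n = {x + int n | x. x \<in> A 0}" using Vn by (auto simp: A_def)
  have compl: "complete_residues m (A t)" if "t \<le> n" for t
    using that
  proof (induction t)
    case 0
    show ?case unfolding A_def
      using m dist strict_mono_on_imp_inj_on[OF mono[of 0]]
      by (intro complete_residuesI) (auto simp: card_image)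
  next
    case (Suc t)
    then show ?case using step[of t] complete_residues_replace[OF m] by simp
  qed
  \<comment> \<open>A jump replaces a minimum by a member of its own progression, so the level sets
    decrease.\<close>
  have progressions_Suc: "progressions m (A (Suc t)) \<subseteq> progressions m (A t)" if "t < n" for t
  proof (rule progressions_subset)
    have "V t (ws ! t) + int m \<in> progressions m (A t)"
      unfolding progressions_def using step(2)[OF that] by (auto intro!: bexI[of _ "V t (ws ! t)"])
    then show "A (Suc t) \<subseteq> progressions m (A t)" using step(1)[OF that] subset_progressions[of "A t" m] by auto
  qed
  have progressions_le: "progressions m (A t) \<subseteq> progressions m (A s)" if "s \<le> t" "t \<le> n" for s t
    using that
  proof (induction t rule: dec_induct)
    case (step t)
    then show ?case using progressions_Suc[of t] by auto
  qed simp
  \<comment> \<open>The level sets decrease from that of \<open>A 0\<close> to that of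
    \<open>A n\<close>, which is the first one moved up by \<open>n\<close>. So adding
    \<open>n\<close> to a level at time \<open>t\<close> leads into the last set, which lies in the
    one at time \<open>t\<close>.\<close>
  have closed: "a + int n \<in> progressions m (A t)" if "t \<le> n" "a \<in> A t" for t a
  proof -
    have "a \<in> progressions m (A 0)" using that subset_progressions progressions_le[of 0 t] by blast
    then obtain b where b: "b \<in> A 0" "b \<le> a" "int m dvd a - b"
      unfolding progressions_def by blast
    have "b + int n \<in> A n" using An b(1) by auto
    moreover have "b + int n \<le> a + int n" "int m dvd (a + int n) - (b + int n)" using b by simp_all
    ultimately have "a + int n \<in> progressions m (A n)" unfolding progressions_def by blast
    then show ?thesis using progressions_le[of t n] that by blast
  qed
  define G where "G t = {p. level m n p \<in> progressions m (A t)}" for t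
  have G: "mn_filter m n (G t)" "row_minima m n (G t) = A t" if "t \<le> n" for t
    unfolding G_def using filter_of_residues[OF m cop compl[OF that] closed[OF that]] by auto
  define fs where "fs = map G [0..<Suc n]"
  define ps where "ps = map (\<lambda>t. V t (ws ! t)) [0..<n]"
  have fs: "fs ! t = G t" if "t \<le> n" for t using that by (simp add: fs_def del: upt_Suc)
  have len_fs: "length fs = n + 1" by (simp add: fs_def)
  have filt: "\<forall>F\<in>set fs. mn_filter m n F" using G(1) by (auto simp: fs_def simp del: upt_Suc)
  have "filter_tuple m n (fs, ps)"
    unfolding filter_tuple_def using len_fs filt step An by (simp add: fs G(2)) (simp add: ps_def)
  moreover have "dyck m n (fs ! 0)"
  proof -
    have "0 \<le> V 0 j" if "j < m" for j
      using strict_mono_on_leD[OF mono[of 0], of 0 j] V0 that by simp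
    then have "0 \<in> A 0" "\<forall>a\<in>A 0. 0 \<le> a" using V0 m by (force simp: A_def)+
    then show ?thesis using dyck_iff_row_minima[OF m cop G(1)[of 0]] G(2)[of 0] fs[of 0] by simp
  qed
  ultimately have P: "(fs, ps) \<in> parking_tuples m n" by (simp add: parking_tuples_def)
  have "B_map m n (fs, ps) = ws"
  proof (rule nth_equalityI)
    fix t assume "t < length (B_map m n (fs, ps))"
    then have t: "t < n" by (simp add: B_map_def)
    then have "B_map m n (fs, ps) ! t = card {x \<in> A t. x < V t (ws ! t)}"
      using fs G(2) by (simp add: B_map_def ps_def)
    then show "B_map m n (fs, ps) ! t = ws ! t"
      using strict_mono_on_rank[OF mono lt] t by (simp add: A_def)
  qed (simp add: B_map_def len)
  then show ?thesis using P by (metis imageI)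
qed

theorem theorem5p5:
  fixes m n :: nat
  assumes "0 < m" and "0 < n" and "coprime m n"
  shows "bij_betw (B_map m n) (parking_tuples m n) (parking_words m n)"
  unfolding bij_betw_def
proof (intro conjI equalityI subsetI)
  show "inj_on (B_map m n) (parking_tuples m n)" using assms by (intro B_map_inj_on)
qed (use assms B_map_parking_word B_map_surj in auto)

end
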